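(* Consider the model of a clique $H$ on $k=k_n$ vertices, $2\le k_n\le n$, planted in $G(n,p)$. (a) If $k_n\to\infty$, then the model exhibits an all-or-nothing (AoN) transition at $$p_{\mathrm{AoN}}=p_{1M}(H)=\binom nk^{-1/\binom k2}.$$ (b) If $k_n=O(1)$, then the model does not exhibit AoN at any value of $p$ (that is, there is no sequence $p_{\mathrm{AoN}}(n)$ at which it exhibits an AoN transition).
   Context: Planted model: let $\mathcal S$ be the set of copies of $H$ in the complete graph $K_n$ and $\mathbf P$ the uniform measure on $\mathcal S$. Graphs in $K_n$ are identified with vectors in $\{0,1\}^{\binom n2}$ (edge indicators). Under $\mathbb P_p$, one observes $\mathbf Y=\mathbf H\cup\mathbf G$, where $\mathbf H\sim\mathbf P$ and $\mathbf G\sim G(n,p)$ is independent of $\mathbf H$. Set $\mathrm{MMSE}_n(p)=\mathbb E_{\mathbb P_p}\big[\|\mathbf H-\mathbb E[\mathbf H\mid\mathbf Y]\|_2^2\big]\in[0,e(H)]$, where $e(H)=\binom k2$ is the number of edges. AoN: the model exhibits an AoN transition at critical probability $p_{\mathrm{AoN}}=p_{\mathrm{AoN}}(n)\in[0,1]$ if for every constant $\epsilon>0$, $\lim_{n\to\infty}\mathrm{MMSE}_n(p)/e(H)=1$ for all $p=p_n\in[0,1]$ with $p_n\ge(1+\epsilon)p_{\mathrm{AoN}}(n)$, and $\lim_{n\to\infty}\mathrm{MMSE}_n(p)/e(H)=0$ for all $p=p_n\in[0,1]$ with $p_n\le(1-\epsilon)p_{\mathrm{AoN}}(n)$. The first moment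 threshold is $p_{1M}(H)=M_H^{-1/e(H)}$, where $M_H$ is the number of copies of $H$ in $K_n$. *)

theory Defs
  imports "HOL-Probability.Probability" "HOL-Library.Landau_Symbols"
begin

text \<open>
  Simple graphs without isolated vertices are represented by their edge sets, an edge being a
  two-element set of natural numbers.
\<close>

definition complete_edges :: "nat \<Rightarrow> nat set set" where
  "complete_edges n = {e. e \<subseteq> {..<n} \<and> card e = 2}"

definition copies :: "nat \<Rightarrow> nat set set \<Rightarrow> nat set set set" where
  "copies n H = {(\<lambda>e. f ` e) ` H | f. inj_on f (\<Union>H) \<and> f ` (\<Union>H) \<subseteq> {..<n}}"

definition gnp :: "nat \<Rightarrow> real \<Rightarrow> nat set set pmf" where
  "gnp n p = map_pmf (\<lambda>b. {e \<in> complete_edges n. b e})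
     (Pi_pmf (complete_edges n) False (\<lambda>_. bernoulli_pmf p))"

text \<open>The sample space consists of pairs (planted copy, noise graph).\<close>

definition planted :: "nat \<Rightarrow> nat set set \<Rightarrow> real \<Rightarrow> (nat set set \<times> nat set set) pmf" where
  "planted n H p = pair_pmf (pmf_of_set (copies n H)) (gnp n p)"

definition obs :: "nat set set \<times> nat set set \<Rightarrow> nat set set" where
  "obs \<omega> = fst \<omega> \<union> snd \<omega>"

definition obs_algebra :: "(nat set set \<times> nat set set) measure" where
  "obs_algebra = vimage_algebra UNIV obs (count_space UNIV)"

text \<open>The conditional expectation of the edge-indicator vector is taken coordinatewise.\<close>

definition MMSE :: "nat \<Rightarrow> nat set set \<Rightarrow> real \<Rightarrow> real" where
  "MMSE n H p = measure_pmf.expectation (planted n H p)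
     (\<lambda>\<omega>. \<Sum>e\<in>complete_edges n.
        (indicator (fst \<omega>) e
          - real_cond_exp (measure_pmf (planted n H p)) obs_algebra
              (\<lambda>\<omega>'. indicator (fst \<omega>') e) \<omega>)\<^sup>2)"

text \<open>
  The limits are taken along those \<open>n\<close> at which \<open>p n\<close> satisfies the required inequality (and hold
  trivially if there are only finitely many such \<open>n\<close>). Demanding the inequality for all \<open>n\<close>
  instead would make the first condition void as soon as \<open>(1 + \<epsilon>) * q n > 1\<close> for a single \<open>n\<close>.
\<close>

definition AoN_at :: "(nat \<Rightarrow> nat set set) \<Rightarrow> (nat \<Rightarrow> real) \<Rightarrow> bool" where
  "AoN_at H q \<longleftrightarrow> (\<forall>n. q n \<in> {0..1}) \<and>
     (\<forall>\<epsilon>>0. \<forall>p. (\<forall>n. p n \<in> {0..1}) \<longrightarrow>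
        ((\<lambda>n. MMSE n (H n) (p n) / real (card (H n))) \<longlongrightarrow> 1)
          (inf sequentially (principal {n. p n \<ge> (1 + \<epsilon>) * q n})) \<and>
        ((\<lambda>n. MMSE n (H n) (p n) / real (card (H n))) \<longlongrightarrow> 0)
          (inf sequentially (principal {n. p n \<le> (1 - \<epsilon>) * q n})))"

definition p1M :: "nat \<Rightarrow> nat set set \<Rightarrow> real" where
  "p1M n H = real (card (copies n H)) powr (- 1 / real (card H))"

end

theory Submission imports Defs "HOL-Real_Asymp.Real_Asymp"
begin

text \<open>
  Given \<open>Y\<close>, the planted copy is uniformly distributed over the copies of \<open>H\<close> contained in \<open>Y\<close>,
  because the likelihood of \<open>Y\<close> is the same for each of them. The minimal mean squared error is
  therefore \<open>e(H)\<close> minus the expected number of edges that the planted copy shares with a second copy,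
  a replica, drawn uniformly from those inside \<open>Y\<close> (\<open>MMSE_eq\<close>). Everything reduces to this overlap.

  For a clique on \<open>k \<rightarrow> \<infinity>\<close> vertices put \<open>m = (k choose 2)\<close> and \<open>M = (n choose k)\<close>, so that
  \<open>p1M = M powr (-1 / m)\<close>. Two cliques with \<open>l\<close> common vertices share \<open>(l choose 2)\<close> edges, and the
  proportion of \<open>k\<close>-sets meeting a given one in \<open>l\<close> vertices is at most
  \<open>(k choose l)\<^sup>2 / (n choose l)\<close>.

  Below the threshold, the error divided by \<open>m\<close> is at most \<open>\<delta>\<close> plus the expected number of cliques in
  \<open>Y\<close> that share fewer than \<open>(1 - \<delta>) m\<close> edges with the planted one (\<open>MMSE_le_far_copies\<close>). Since
  \<open>M powr ((l choose 2) / m) / (n choose l) \<le> exp l\<close>, this number is at most \<open>exp (O(k))\<close> times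
  \<open>(1 - \<epsilon>) powr (\<delta> m)\<close>, which vanishes because \<open>m\<close> is quadratic in \<open>k\<close>.

  Above the threshold, a second moment argument for the number of cliques in \<open>G(n,p)\<close> bounds the
  overlap by \<open>4 m\<close> times the sum of \<open>(1/p) ^ \<bar>h \<inter> h'\<bar>\<close> over pairs of cliques sharing an edge, divided by \<open>M\<^sup>2\<close>
  (\<open>MMSE_ge_second_moment\<close>). Here \<open>p \<le> 1\<close> helps: \<open>(1 + \<epsilon>) p1M \<le> 1\<close> forces \<open>n / k\<close> to be exponentially
  large in \<open>k\<close>. Small overlaps are then rare because \<open>k / n\<close> is tiny, and large ones are suppressed
  by the factor \<open>(1 + \<epsilon>) powr (- (l choose 2))\<close>.

  For bounded \<open>k\<close>, consider the probability that \<open>Y\<close> contains a copy other than the planted one. It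
  agrees with the error up to factors depending on \<open>e(H)\<close> only. Replacing \<open>p\<close> by \<open>r p\<close> amounts to
  keeping each noise edge with probability \<open>r\<close>; a second copy survives this with probability at least
  \<open>r ^ e(H)\<close>. Hence the error at \<open>q/2\<close> cannot vanish if it is of full order at \<open>3q/2\<close>, and no \<open>q\<close> can
  be an all-or-nothing threshold (\<open>not_AoN_at_bounded\<close>).
\<close>

section \<open>Random subsets\<close>

text \<open>
  The probability that a random subset of \<open>S\<close>, containing each element independently with
  probability \<open>p\<close>, equals \<open>G\<close>.
\<close>

definition weight :: "'a set \<Rightarrow> real \<Rightarrow> 'a set \<Rightarrow> real" where
  "weight S p G = p ^ card G * (1 - p) ^ card (S - G)"

lemma weight_nonneg: "0 \<le> p \<Longrightarrow> p \<le> 1 \<Longrightarrow> 0 \<le> weight S p G"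
  by (simp add: weight_def)

lemma sum_Pow_split:
  assumes "A \<subseteq> S"
  shows "(\<Sum>G\<in>Pow S. F G) = (\<Sum>A'\<in>Pow A. \<Sum>B\<in>Pow (S - A). F (A' \<union> B))"
proof -
  have "(\<Sum>A'\<in>Pow A. \<Sum>B\<in>Pow (S - A). F (A' \<union> B))
      = (\<Sum>(A', B)\<in>Pow A \<times> Pow (S - A). F (A' \<union> B))"
    by (rule sum.cartesian_product)
  also have "\<dots> = (\<Sum>G\<in>Pow S. F G)"
    by (rule sum.reindex_bij_witness[where i = "\<lambda>G. (G \<inter> A, G - A)" and j = "\<lambda>(A', B). A' \<union> B"])
       (use assms in \<open>auto simp: Un_Diff_Int Un_commute Int_commute\<close>)
  finally show ?thesis by simp
qed

lemma sum_Pow_power_card: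
  fixes a b :: real
  assumes "finite S"
  shows "(\<Sum>B\<in>Pow S. a ^ card B * b ^ card (S - B)) = (a + b) ^ card S"
  using prod_add[OF assms, of "\<lambda>_. a" "\<lambda>_. b"] by simp

lemma sum_weight: "finite S \<Longrightarrow> (\<Sum>G\<in>Pow S. weight S p G) = 1"
  by (simp add: weight_def sum_Pow_power_card)

lemma weight_Un:
  assumes "finite S" "A \<subseteq> S" "A' \<subseteq> A" "B \<subseteq> S - A"
  shows "weight S p (A' \<union> B) = weight A p A' * weight (S - A) p B"
proof -
  have fin: "finite A" "finite A'" "finite B"
    using assms by (auto intro: finite_subset)
  have "card (A' \<union> B) = card A' + card B"
    using assms fin by (intro card_Un_disjoint) auto
  moreover have "card (S - (A' \<union> B)) = card (A - A') + card (S - A - B)"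
  proof -
    have "S - (A' \<union> B) = (A - A') \<union> (S - A - B)" using assms by auto
    moreover have "card ((A - A') \<union> (S - A - B)) = card (A - A') + card (S - A - B)"
      using assms fin by (intro card_Un_disjoint) auto
    ultimately show ?thesis by simp
  qed
  ultimately show ?thesis by (simp add: weight_def power_add algebra_simps)
qed

text \<open>
  The elements of the random set \<open>G\<close> that lie in \<open>A\<close> are invisible in \<open>A \<union> G\<close>, so they can be
  summed out.
\<close>

lemma sum_weight_Un:
  assumes "finite S" "A \<subseteq> S"
  shows "(\<Sum>G\<in>Pow S. weight S p G * F (A \<union> G)) = (\<Sum>B\<in>Pow (S - A). weight (S - A) p B * F (A \<union> B))"
proof -
  have "(\<Sum>G\<in>Pow S. weight S p G * F (A \<union> G))
      = (\<Sum>A'\<in>Pow A. \<Sum>B\<in>Pow (S - A). weight S p (A' \<union> B) * F (A \<union> (A' \<union> B)))"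
    by (rule sum_Pow_split[OF assms(2)])
  also have "\<dots> = (\<Sum>A'\<in>Pow A. \<Sum>B\<in>Pow (S - A). weight A p A' * (weight (S - A) p B * F (A \<union> B)))"
    by (intro sum.cong refl) (use assms weight_Un[OF assms] in \<open>auto simp: Un_assoc[symmetric] Un_absorb2\<close>)
  also have "\<dots> = (\<Sum>A'\<in>Pow A. weight A p A') * (\<Sum>B\<in>Pow (S - A). weight (S - A) p B * F (A \<union> B))"
    by (simp add: sum_product)
  also have "(\<Sum>A'\<in>Pow A. weight A p A') = 1"
    using assms by (intro sum_weight) (auto intro: finite_subset)
  finally show ?thesis by simp
qed

lemma sum_weight_contains:
  assumes "finite S" "D \<subseteq> S"
  shows "(\<Sum>G\<in>Pow S. weight S p G * of_bool (D \<subseteq> G)) = p ^ card D"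
proof -
  have fin: "finite D" using assms by (auto intro: finite_subset)
  have "(\<Sum>G\<in>Pow S. weight S p G * of_bool (D \<subseteq> G))
      = (\<Sum>A'\<in>Pow D. \<Sum>B\<in>Pow (S - D). weight S p (A' \<union> B) * of_bool (D \<subseteq> A' \<union> B))"
    by (rule sum_Pow_split[OF assms(2)])
  also have "\<dots> = (\<Sum>A'\<in>Pow D. \<Sum>B\<in>Pow (S - D). (weight D p A' * of_bool (A' = D)) * weight (S - D) p B)"
    by (intro sum.cong refl) (use assms weight_Un[OF assms] in auto)
  also have "\<dots> = (\<Sum>A'\<in>Pow D. weight D p A' * of_bool (A' = D)) * (\<Sum>B\<in>Pow (S - D). weight (S - D) p B)"
    by (simp add: sum_product)
  also have "(\<Sum>B\<in>Pow (S - D). weight (S - D) p B) = 1"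
    using assms by (intro sum_weight) auto
  also have "(\<Sum>A'\<in>Pow D. weight D p A' * of_bool (A' = D)) = p ^ card D"
    using fin by (subst sum.mono_neutral_right[where S = "{D}"]) (auto simp: weight_def)
  finally show ?thesis by simp
qed

text \<open>
  A random set of density \<open>r p\<close> arises by drawing one of density \<open>p\<close> and then keeping each of its
  elements with probability \<open>r\<close>. This couples the noise at two densities.
\<close>

lemma sum_weight_thinning:
  assumes "finite S"
  shows "(\<Sum>T\<in>Pow S. weight S (r * p) T * F T)
       = (\<Sum>G\<in>Pow S. weight S p G * (\<Sum>T\<in>Pow G. weight G r T * F T))"
proof -
  have eq: "(\<Sum>G\<in>{G\<in>Pow S. T \<subseteq> G}. weight S p G * weight G r T) = weight S (r * p) T"
    if T: "T \<in> Pow S" for T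
  proof -
    have finT: "finite T" using T assms finite_subset by auto
    \<comment> \<open>Each point outside \<open>T\<close> was either drawn and then deleted, or never drawn.\<close>
    have "(\<Sum>G\<in>{G\<in>Pow S. T \<subseteq> G}. weight S p G * weight G r T)
        = (\<Sum>B\<in>Pow (S - T). weight S p (T \<union> B) * weight (T \<union> B) r T)"
      by (rule sum.reindex_bij_witness[where i = "\<lambda>B. T \<union> B" and j = "\<lambda>G. G - T"])
         (use T in \<open>auto simp: Un_absorb1 Un_Diff_cancel\<close>)
    also have "\<dots> = (\<Sum>B\<in>Pow (S - T). (r * p) ^ card T *
                 ((p * (1 - r)) ^ card B * (1 - p) ^ card (S - T - B)))"
    proof (intro sum.cong refl)
      fix B assume B: "B \<in> Pow (S - T)"
      have finB: "finite B" using B assms finite_subset by auto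
      have "card (T \<union> B) = card T + card B"
        using B finT finB by (intro card_Un_disjoint) auto
      moreover have "T \<union> B - T = B" "S - (T \<union> B) = S - T - B" using B by auto
      ultimately show "weight S p (T \<union> B) * weight (T \<union> B) r T = (r * p) ^ card T *
                 ((p * (1 - r)) ^ card B * (1 - p) ^ card (S - T - B))"
        by (simp add: weight_def power_add power_mult_distrib mult_ac)
    qed
    also have "\<dots> = (r * p) ^ card T * (p * (1 - r) + (1 - p)) ^ card (S - T)"
      using assms by (simp add: sum_distrib_left[symmetric] sum_Pow_power_card)
    also have "p * (1 - r) + (1 - p) = 1 - r * p" by (simp add: algebra_simps)
    finally show ?thesis by (simp add: weight_def)
  qed
  have "(\<Sum>G\<in>Pow S. weight S p G * (\<Sum>T\<in>Pow G. weight G r T * F T))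
      = (\<Sum>G\<in>Pow S. \<Sum>T\<in>{T\<in>Pow S. T \<subseteq> G}. weight S p G * weight G r T * F T)"
    by (intro sum.cong refl) (auto simp: sum_distrib_left mult.assoc intro!: sum.cong)
  also have "\<dots> = (\<Sum>T\<in>Pow S. \<Sum>G\<in>{G\<in>Pow S. T \<subseteq> G}. weight S p G * weight G r T * F T)"
    using assms by (intro sum.swap_restrict) auto
  also have "\<dots> = (\<Sum>T\<in>Pow S. weight S (r * p) T * F T)"
    by (intro sum.cong refl) (simp only: sum_distrib_right[symmetric] eq)
  finally show ?thesis by simp
qed

section \<open>The planted model and its posterior\<close>

lemma finite_complete_edges [simp]: "finite (complete_edges n)"
  unfolding complete_edges_def by (rule finite_subset[of _ "Pow {..<n}"]) auto

lemma pmf_gnp: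
  assumes "0 \<le> p" "p \<le> 1" "G \<subseteq> complete_edges n"
  shows "pmf (gnp n p) G = weight (complete_edges n) p G"
proof -
  define E where "E = complete_edges n"
  have fin: "finite E" and GE: "G \<subseteq> E" using assms by (auto simp: E_def)
  let ?P = "Pi_pmf E False (\<lambda>_. bernoulli_pmf p)"
  have "pmf (gnp n p) G = measure ?P ((\<lambda>b. {e \<in> E. b e}) -` {G})"
    by (simp add: gnp_def pmf_map E_def)
  also have "\<dots> = measure ?P {\<lambda>e. e \<in> G}"
  proof (rule measure_prob_cong_0)
    fix b assume b: "b \<in> (\<lambda>b. {e \<in> E. b e}) -` {G} - {\<lambda>e. e \<in> G}"
    hence "\<exists>x. x \<notin> E \<and> b x \<noteq> False" by (auto simp: fun_eq_iff)
    thus "pmf ?P b = 0" by (intro pmf_Pi_outside fin)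
  qed (use GE in auto)
  also have "\<dots> = (\<Prod>e\<in>E. pmf (bernoulli_pmf p) (e \<in> G))"
    using fin GE by (auto simp: measure_pmf_single pmf_Pi)
  also have "\<dots> = (\<Prod>e\<in>G. pmf (bernoulli_pmf p) (e \<in> G)) * (\<Prod>e\<in>E - G. pmf (bernoulli_pmf p) (e \<in> G))"
    using fin GE by (simp add: prod.subset_diff mult.commute)
  also have "\<dots> = weight E p G"
    using assms by (simp add: weight_def)
  finally show ?thesis by (simp add: E_def)
qed

lemma set_pmf_gnp: "set_pmf (gnp n p) \<subseteq> Pow (complete_edges n)"
  by (auto simp: gnp_def)

text \<open>
  The Bayesian analysis works for an arbitrary finite graph \<open>H\<close> that fits into \<open>n\<close> vertices. It uses
  that the copies of \<open>H\<close> are finitely many sets of edges, all of the same cardinality.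
\<close>

locale planted_graph =
  fixes n :: nat and H :: "nat set set"
  assumes finite_H: "finite H"
    and edges_H: "\<And>e. e \<in> H \<Longrightarrow> card e = 2"
    and copies_nonempty: "copies n H \<noteq> {}"
begin

abbreviation "C \<equiv> copies n H"
abbreviation "E \<equiv> complete_edges n"
abbreviation "m \<equiv> card H"

definition inside :: "nat set set \<Rightarrow> nat set set set" where
  "inside y = {h \<in> C. h \<subseteq> y}"

lemma copy_subset: "h \<in> C \<Longrightarrow> h \<subseteq> E"
proof
  fix e assume "h \<in> C" "e \<in> h"
  then obtain f d where f: "inj_on f (\<Union>H)" "f ` \<Union>H \<subseteq> {..<n}" "d \<in> H" "e = f ` d"
    by (auto simp: copies_def)
  have "card e = card d"
    unfolding f by (rule card_image) (use f in \<open>auto intro: inj_on_subset\<close>)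
  with f edges_H show "e \<in> E" by (auto simp: complete_edges_def)
qed

lemma card_copy: 
  assumes "h \<in> C" shows "card h = m"
proof -
  obtain f where f: "inj_on f (\<Union>H)" "h = (\<lambda>e. f ` e) ` H"
    using assms by (auto simp: copies_def)
  show ?thesis unfolding f(2)
    by (rule card_image) (use f(1) inj_on_image in auto)
qed

lemma finite_copy: "h \<in> C \<Longrightarrow> finite h"
  using copy_subset finite_complete_edges by (blast intro: finite_subset)

lemma finite_copies: "finite C"
  by (rule finite_subset[of _ "Pow E"]) (use copy_subset in auto)

lemma card_copies_pos: "0 < card C"
  using finite_copies copies_nonempty by (simp add: card_gt_0_iff)

lemma finite_inside [simp]: "finite (inside y)"
  using finite_copies by (simp add: inside_def)

text \<open>
  The sample space is finite, so the joint law of the planted copy and the observed graph can be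
  handled by finite sums; Bayes' rule then becomes an exchange of summations.
\<close>

definition joint_mean :: "real \<Rightarrow> (nat set set \<Rightarrow> nat set set \<Rightarrow> real) \<Rightarrow> real" where
  "joint_mean p F = (\<Sum>h\<in>C. \<Sum>G\<in>Pow E. weight E p G * F h (h \<union> G)) / card C"

text \<open>
  The probability of observing \<open>y\<close> when a fixed copy \<open>h \<subseteq> y\<close> is planted. It does not depend
  on \<open>h\<close>, which makes the posterior distribution uniform.
\<close>

definition likelihood :: "real \<Rightarrow> nat set set \<Rightarrow> real" where
  "likelihood p y = p ^ (card y - m) * (1 - p) ^ card (E - y)"

lemma expectation_planted:
  assumes "0 \<le> p" "p \<le> 1"
  shows "measure_pmf.expectation (planted n H p) (\<lambda>\<omega>. F (fst \<omega>) (obs \<omega>)) = joint_mean p F"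
proof -
  have "measure_pmf.expectation (planted n H p) (\<lambda>\<omega>. F (fst \<omega>) (obs \<omega>))
      = (\<Sum>\<omega>\<in>C \<times> Pow E. F (fst \<omega>) (obs \<omega>) * pmf (planted n H p) \<omega>)"
    by (rule integral_measure_pmf_real)
       (use set_pmf_gnp finite_copies copies_nonempty in
         \<open>auto simp: planted_def set_pmf_of_set\<close>)
  also have "\<dots> = (\<Sum>(h, G)\<in>C \<times> Pow E. weight E p G * F h (h \<union> G) / card C)"
    by (intro sum.cong refl)
       (use assms finite_copies copies_nonempty in
         \<open>auto simp: planted_def pmf_pair pmf_gnp obs_def pmf_of_set[OF copies_nonempty finite_copies]\<close>)
  also have "\<dots> = joint_mean p F"
    by (simp add: joint_mean_def sum.cartesian_product[symmetric] sum_divide_distrib)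
  finally show ?thesis .
qed

text \<open>
  Exchanging the order of summation puts the observed graph first: given \<open>y\<close>, all copies inside \<open>y\<close>
  carry the same weight.
\<close>

lemma joint_mean_Bayes:
  "joint_mean p F = (\<Sum>y\<in>Pow E. likelihood p y * (\<Sum>h\<in>inside y. F h y)) / card C"
proof -
  have *: "(\<Sum>G\<in>Pow E. weight E p G * F h (h \<union> G)) = (\<Sum>y\<in>{y \<in> Pow E. h \<subseteq> y}. likelihood p y * F h y)"
    if h: "h \<in> C" for h
  proof -
    note hE = copy_subset[OF h]
    have "(\<Sum>G\<in>Pow E. weight E p G * F h (h \<union> G))
        = (\<Sum>B\<in>Pow (E - h). weight (E - h) p B * F h (h \<union> B))"
      by (rule sum_weight_Un) (use hE in auto)
    also have "\<dots> = (\<Sum>y\<in>{y \<in> Pow E. h \<subseteq> y}. likelihood p y * F h y)"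
    proof (rule sum.reindex_bij_witness[where i = "\<lambda>y. y - h" and j = "\<lambda>B. h \<union> B"])
      fix B assume B: "B \<in> Pow (E - h)"
      have "finite B" using B finite_subset by fastforce
      hence "card (h \<union> B) = m + card B"
        using B finite_copy[OF h] card_copy[OF h] by (subst card_Un_disjoint) auto
      moreover have "E - (h \<union> B) = E - h - B" by auto
      ultimately show "likelihood p (h \<union> B) * F h (h \<union> B) = weight (E - h) p B * F h (h \<union> B)"
        by (simp add: likelihood_def weight_def)
    qed (use hE in auto)
    finally show ?thesis .
  qed
  have "(\<Sum>h\<in>C. \<Sum>G\<in>Pow E. weight E p G * F h (h \<union> G))
      = (\<Sum>h\<in>C. \<Sum>y\<in>{y \<in> Pow E. h \<subseteq> y}. likelihood p y * F h y)"
    by (intro sum.cong refl *)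
  also have "\<dots> = (\<Sum>y\<in>Pow E. \<Sum>h\<in>{h \<in> C. h \<subseteq> y}. likelihood p y * F h y)"
    by (rule sum.swap_restrict) (auto simp: finite_copies)
  finally show ?thesis
    by (simp add: joint_mean_def inside_def sum_distrib_left)
qed

lemma joint_mean_mono:
  assumes "0 \<le> p" "p \<le> 1" "\<And>h G. h \<in> C \<Longrightarrow> G \<subseteq> E \<Longrightarrow> F h (h \<union> G) \<le> F' h (h \<union> G)"
  shows "joint_mean p F \<le> joint_mean p F'"
  unfolding joint_mean_def
  by (intro divide_right_mono sum_mono mult_left_mono weight_nonneg) (use assms in auto)

lemma joint_mean_const: "joint_mean p (\<lambda>_ _. c) = c"
  using card_copies_pos by (simp add: joint_mean_def sum_distrib_right[symmetric] sum_weight)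

lemma joint_mean_add: "joint_mean p (\<lambda>h y. F h y + F' h y) = joint_mean p F + joint_mean p F'"
  by (simp add: joint_mean_def algebra_simps sum.distrib add_divide_distrib)

lemma joint_mean_cmult: "joint_mean p (\<lambda>h y. c * F h y) = c * joint_mean p F"
  by (simp add: joint_mean_def sum_distrib_left mult.left_commute)

definition posterior :: "nat set \<Rightarrow> nat set set \<Rightarrow> real" where
  "posterior e y = (\<Sum>h\<in>inside y. indicator h e) / card (inside y)"

text \<open>
  Over any event determined by the observed graph, the indicator of \<open>e\<close> and the fraction of copies
  containing \<open>e\<close> have the same integral, since both have the same sum over the copies inside \<open>y\<close>.
\<close>

lemma cond_exp_planted:
  assumes p: "0 \<le> p" "p \<le> 1"
  shows "AE \<omega> in planted n H p.
           real_cond_exp (planted n H p) obs_algebra (\<lambda>\<omega>'. indicator (fst \<omega>') e) \<omega> = posterior e (obs \<omega>)"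
proof -
  let ?M = "measure_pmf (planted n H p)"
  have sub: "subalgebra ?M obs_algebra"
    by (simp add: subalgebra_def obs_algebra_def)
  interpret finite_measure_subalgebra ?M obs_algebra
    by unfold_locales (rule sub)
  have fin: "finite (set_pmf (planted n H p))"
    by (rule finite_subset[of _ "C \<times> Pow E"])
       (use set_pmf_gnp finite_copies copies_nonempty in \<open>auto simp: planted_def set_pmf_of_set\<close>)
  have int: "integrable ?M f" for f :: "_ \<Rightarrow> real"
    by (rule integrable_measure_pmf_finite[OF fin])
  show ?thesis
  proof (rule real_cond_exp_charact)
    fix A assume "A \<in> sets obs_algebra"
    then obtain B where B: "A = obs -` B"
      by (auto simp: obs_algebra_def sets_vimage_algebra2)
    have "(\<integral>\<omega>\<in>A. (indicator (fst \<omega>) e :: real) \<partial>?M)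
        = measure_pmf.expectation (planted n H p) (\<lambda>\<omega>. indicator B (obs \<omega>) * indicator (fst \<omega>) e)"
      by (simp add: set_lebesgue_integral_def B indicator_def)
    also have "\<dots> = joint_mean p (\<lambda>h y. indicator B y * indicator h e)"
      by (rule expectation_planted[OF p])
    also have "\<dots> = joint_mean p (\<lambda>h y. indicator B y * posterior e y)"
    proof -
      have "(\<Sum>h\<in>inside y. indicator B y * indicator h e) = (\<Sum>h\<in>inside y. indicator B y * posterior e y)" for y
        by (auto simp: posterior_def sum_distrib_left[symmetric])
      thus ?thesis by (simp only: joint_mean_Bayes)
    qed
    also have "\<dots> = measure_pmf.expectation (planted n H p) (\<lambda>\<omega>. indicator B (obs \<omega>) * posterior e (obs \<omega>))"
      by (rule expectation_planted[OF p, symmetric])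
    also have "\<dots> = (\<integral>\<omega>\<in>A. posterior e (obs \<omega>) \<partial>?M)"
      by (simp add: set_lebesgue_integral_def B indicator_def)
    finally show "(\<integral>\<omega>\<in>A. (indicator (fst \<omega>) e :: real) \<partial>?M) = (\<integral>\<omega>\<in>A. posterior e (obs \<omega>) \<partial>?M)" .
  next
    have "obs \<in> measurable obs_algebra (count_space UNIV)"
      unfolding obs_algebra_def by (rule measurable_vimage_algebra1) auto
    thus "(\<lambda>\<omega>. posterior e (obs \<omega>)) \<in> borel_measurable obs_algebra"
      by (rule measurable_compose) simp
  qed (rule int)+
qed

text \<open>
  The mean number of edges that \<open>h\<close> shares with a replica, that is, with a copy drawn from the
  posterior distribution given \<open>y\<close>.
\<close>

definition replica_overlap :: "nat set set \<Rightarrow> nat set set \<Rightarrow> real" where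
  "replica_overlap h y = (\<Sum>h'\<in>inside y. real (card (h \<inter> h'))) / card (inside y)"

lemma sum_indicator_edges: "h \<in> C \<Longrightarrow> (\<Sum>e\<in>E. indicator h e * f e) = (\<Sum>e\<in>h. f e :: real)"
  using copy_subset[of h] by (auto simp: indicator_def if_distrib sum.If_cases Int_absorb1 cong: if_cong intro!: sum.mono_neutral_cong_right)

text \<open>
  The squared distance of a random vector to its conditional mean is its squared norm minus the inner
  product with the conditional mean. For indicator vectors of copies the first term is the number of
  edges and the second is the replica overlap.
\<close>

lemma MMSE_eq:
  assumes p: "0 \<le> p" "p \<le> 1"
  shows "MMSE n H p = joint_mean p (\<lambda>h y. m - replica_overlap h y)"
proof -
  have "MMSE n H p = measure_pmf.expectation (planted n H p)
          (\<lambda>\<omega>. \<Sum>e\<in>E. (indicator (fst \<omega>) e - posterior e (obs \<omega>))\<^sup>2)"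
    unfolding MMSE_def
  proof (rule integral_cong_AE)
    have "AE \<omega> in planted n H p. \<forall>e\<in>E. 
           real_cond_exp (planted n H p) obs_algebra (\<lambda>\<omega>'. indicator (fst \<omega>') e) \<omega> = posterior e (obs \<omega>)"
      by (intro AE_finite_allI cond_exp_planted p) simp
    thus "AE \<omega> in planted n H p. (\<Sum>e\<in>E. (indicator (fst \<omega>) e -
            real_cond_exp (planted n H p) obs_algebra (\<lambda>\<omega>'. indicator (fst \<omega>') e) \<omega>)\<^sup>2)
          = (\<Sum>e\<in>E. (indicator (fst \<omega>) e - posterior e (obs \<omega>))\<^sup>2)"
      by eventually_elim simp
  qed auto
  also have "\<dots> = joint_mean p (\<lambda>h y. \<Sum>e\<in>E. (indicator h e - posterior e y)\<^sup>2)"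
    by (rule expectation_planted[OF p])
  also have "\<dots> = joint_mean p (\<lambda>h y. m - replica_overlap h y)"
  proof -
    have "(\<Sum>h\<in>inside y. \<Sum>e\<in>E. (indicator h e - posterior e y)\<^sup>2)
        = (\<Sum>h\<in>inside y. m - replica_overlap h y)" for y
    proof -
      \<comment> \<open>The sum over the copies inside \<open>y\<close> turns the mixed and the quadratic term into multiples
      of each other.\<close>
      have e: "(\<Sum>h\<in>inside y. (indicator h e - posterior e y)\<^sup>2)
          = (\<Sum>h\<in>inside y. indicator h e * (1 - posterior e y))" for e
      proof -
        let ?X = "real (card (inside y))" and ?g = "posterior e y"
        have g: "(\<Sum>h\<in>inside y. indicator h e) = ?X * ?g"
          by (auto simp: posterior_def)
        have "(\<Sum>h\<in>inside y. (indicator h e - ?g)\<^sup>2)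
            = (\<Sum>h\<in>inside y. indicator h e - 2 * ?g * indicator h e + ?g\<^sup>2)"
          by (intro sum.cong refl) (auto simp: indicator_def power2_eq_square algebra_simps)
        also have "\<dots> = ?X * ?g - 2 * ?g * (?X * ?g) + ?X * ?g\<^sup>2"
          by (simp add: sum.distrib sum_subtractf sum_distrib_left[symmetric] g)
        also have "\<dots> = (\<Sum>h\<in>inside y. indicator h e) * (1 - ?g)"
          unfolding g by (simp add: power2_eq_square algebra_simps)
        finally show ?thesis by (simp add: sum_distrib_right)
      qed
      have "(\<Sum>h\<in>inside y. \<Sum>e\<in>E. (indicator h e - posterior e y)\<^sup>2)
          = (\<Sum>h\<in>inside y. \<Sum>e\<in>E. indicator h e * (1 - posterior e y))"
        by (subst (1 2) sum.swap) (simp add: e)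
      also have "\<dots> = (\<Sum>h\<in>inside y. m - replica_overlap h y)"
      proof (intro sum.cong refl)
        fix h assume "h \<in> inside y"
        hence h: "h \<in> C" by (simp add: inside_def)
        have "(\<Sum>e\<in>E. indicator h e * (1 - posterior e y)) = (\<Sum>e\<in>h. 1 - posterior e y)"
          by (rule sum_indicator_edges[OF h])
        also have "\<dots> = m - (\<Sum>e\<in>h. posterior e y)"
          using card_copy[OF h] by (simp add: sum_subtractf)
        also have "(\<Sum>e\<in>h. posterior e y) = (\<Sum>h'\<in>inside y. \<Sum>e\<in>h. indicator h' e) / card (inside y)"
          unfolding posterior_def sum_divide_distrib[symmetric] by (subst sum.swap) simp
        also have "\<dots> = replica_overlap h y"
          using finite_copy[OF h] by (simp add: replica_overlap_def sum.If_cases indicator_def)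
        finally show "(\<Sum>e\<in>E. indicator h e * (1 - posterior e y)) = m - replica_overlap h y" .
      qed
      finally show ?thesis .
    qed
    thus ?thesis by (simp only: joint_mean_Bayes)
  qed
  finally show ?thesis .
qed

lemma inside_self: "h \<in> C \<Longrightarrow> h \<in> inside (h \<union> G)"
  by (simp add: inside_def)

lemma card_inside_pos: "h \<in> inside y \<Longrightarrow> 0 < card (inside y)"
  by (auto simp: card_gt_0_iff)

lemma card_Int_copies_le: "h \<in> C \<Longrightarrow> card (h \<inter> h') \<le> m"
  using card_mono[of h "h \<inter> h'"] card_copy finite_copy by auto

lemma card_Int_copies_less:
  assumes "h \<in> C" "h' \<in> C" "h' \<noteq> h"
  shows "card (h \<inter> h') < m"
proof -
  have "h \<inter> h' \<noteq> h"
    using assms card_subset_eq[of h' h] finite_copy card_copy by auto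
  thus ?thesis
    using psubset_card_mono[of h "h \<inter> h'"] assms finite_copy card_copy by auto
qed

lemma error_as_sum:
  assumes "h \<in> inside y"
  shows "m - replica_overlap h y = (\<Sum>h'\<in>inside y. real m - card (h \<inter> h')) / card (inside y)"
  using card_inside_pos[OF assms]
  by (auto simp: replica_overlap_def sum_subtractf divide_simps)

lemma replica_overlap_nonneg: "0 \<le> replica_overlap h y"
  by (simp add: replica_overlap_def sum_nonneg)

lemma replica_overlap_le:
  assumes "h \<in> inside y" shows "replica_overlap h y \<le> m"
proof -
  have "h \<in> C" using assms by (simp add: inside_def)
  hence "0 \<le> m - replica_overlap h y"
    unfolding error_as_sum[OF assms] by (intro divide_nonneg_nonneg sum_nonneg) (auto simp: card_Int_copies_le)
  thus ?thesis by simp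
qed

lemma MMSE_nonneg: "0 \<le> p \<Longrightarrow> p \<le> 1 \<Longrightarrow> 0 \<le> MMSE n H p"
  using joint_mean_mono[of p "\<lambda>_ _. 0" "\<lambda>h y. m - replica_overlap h y"]
  by (simp add: MMSE_eq joint_mean_const replica_overlap_le inside_self)

lemma MMSE_le_card: "0 \<le> p \<Longrightarrow> p \<le> 1 \<Longrightarrow> MMSE n H p \<le> m"
  using joint_mean_mono[of p "\<lambda>h y. m - replica_overlap h y" "\<lambda>_ _. m"]
  by (simp add: MMSE_eq joint_mean_const replica_overlap_nonneg)

text \<open>
  A replica missing at most \<open>\<delta> m\<close> edges of the planted copy costs at most \<open>\<delta> m\<close>. The other copies are
  controlled by their expected number: the posterior probability of each is at most 1, and a copy \<open>h'\<close>
  appears next to \<open>h\<close> when the noise supplies the edges of \<open>h' - h\<close>.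
\<close>

lemma MMSE_le_far_copies:
  fixes \<delta> :: real
  assumes p: "0 \<le> p" "p \<le> 1" and \<delta>: "0 \<le> \<delta>"
  shows "MMSE n H p \<le> m * (\<delta> +
    (\<Sum>h\<in>C. \<Sum>h'\<in>{h'\<in>C. card (h \<inter> h') < (1 - \<delta>) * m}. p ^ (m - card (h \<inter> h'))) / card C)"
proof -
  let ?far = "\<lambda>h. {h'\<in>C. card (h \<inter> h') < (1 - \<delta>) * m}"
  have finfar: "finite (?far h)" for h using finite_copies by simp
  have "MMSE n H p = joint_mean p (\<lambda>h y. m - replica_overlap h y)" by (rule MMSE_eq[OF p])
  also have "\<dots> \<le> joint_mean p (\<lambda>h y. m * \<delta> + m * (\<Sum>h'\<in>?far h. of_bool (h' \<subseteq> y)))"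
  proof (rule joint_mean_mono[OF p])
    fix h G assume h: "h \<in> C"
    define y where "y = h \<union> G"
    have hy: "h \<in> inside y" using inside_self[OF h] by (simp add: y_def)
    define X where "X = real (card (inside y))"
    define N where "N = (\<Sum>h'\<in>?far h. of_bool (h' \<subseteq> y) :: real)"
    have X: "1 \<le> X" using card_inside_pos[OF hy] by (simp add: X_def)
    have N: "0 \<le> N" by (simp add: N_def sum_nonneg)
    have "(\<Sum>h'\<in>inside y. real m - card (h \<inter> h'))
        \<le> (\<Sum>h'\<in>inside y. m * \<delta> + m * of_bool (card (h \<inter> h') < (1 - \<delta>) * m))"
    proof (rule sum_mono)
      fix h' assume "h' \<in> inside y"
      show "real m - card (h \<inter> h') \<le> m * \<delta> + m * of_bool (card (h \<inter> h') < (1 - \<delta>) * m)"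
        using \<delta> by (cases "card (h \<inter> h') < (1 - \<delta>) * m") (auto simp: algebra_simps intro: add_increasing2)
    qed
    also have "\<dots> = X * (m * \<delta>) + m * (\<Sum>h'\<in>inside y. of_bool (card (h \<inter> h') < (1 - \<delta>) * m) :: real)"
      by (simp add: sum.distrib sum_distrib_left X_def)
    also have "(\<Sum>h'\<in>inside y. of_bool (card (h \<inter> h') < (1 - \<delta>) * m)) = N"
    proof -
      have "inside y \<inter> {h'. card (h \<inter> h') < (1 - \<delta>) * m} = ?far h \<inter> {h'. h' \<subseteq> y}"
        by (auto simp: inside_def)
      thus ?thesis
        using finfar[of h] by (simp add: N_def sum_of_bool_eq)
    qed
    also have "X * (m * \<delta>) + m * N \<le> X * (m * \<delta>) + X * (m * N)" using X N mult_right_mono[of 1 X "m * N"] by simp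
    finally have "(\<Sum>h'\<in>inside y. real m - card (h \<inter> h')) \<le> (m * \<delta> + m * N) * X"
      by (simp add: algebra_simps)
    hence "m - replica_overlap h y \<le> m * \<delta> + m * N"
      unfolding error_as_sum[OF hy] using X by (simp add: pos_divide_le_eq X_def)
    thus "m - replica_overlap h (h \<union> G) \<le> m * \<delta> + m * (\<Sum>h'\<in>?far h. of_bool (h' \<subseteq> h \<union> G))"
      by (simp add: y_def N_def)
  qed
  also have "\<dots> = m * \<delta> + m * joint_mean p (\<lambda>h y. \<Sum>h'\<in>?far h. of_bool (h' \<subseteq> y))"
    by (simp add: joint_mean_add joint_mean_cmult joint_mean_const)
  also have "joint_mean p (\<lambda>h y. \<Sum>h'\<in>?far h. of_bool (h' \<subseteq> y))
      = (\<Sum>h\<in>C. \<Sum>h'\<in>?far h. p ^ (m - card (h \<inter> h'))) / card C"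
  proof -
    have "(\<Sum>G\<in>Pow E. weight E p G * (\<Sum>h'\<in>?far h. of_bool (h' \<subseteq> h \<union> G)))
        = (\<Sum>h'\<in>?far h. p ^ (m - card (h \<inter> h')))" if h: "h \<in> C" for h
    proof -
      have "(\<Sum>G\<in>Pow E. weight E p G * (\<Sum>h'\<in>?far h. of_bool (h' \<subseteq> h \<union> G)))
          = (\<Sum>h'\<in>?far h. \<Sum>G\<in>Pow E. weight E p G * of_bool (h' - h \<subseteq> G))"
        unfolding sum_distrib_left by (subst sum.swap) (simp add: Diff_subset_conv)
      also have "\<dots> = (\<Sum>h'\<in>?far h. p ^ (m - card (h \<inter> h')))"
      proof (intro sum.cong refl)
        fix h' assume "h' \<in> ?far h"
        hence h': "h' \<in> C" by simp
        have "card (h' - h) = m - card (h \<inter> h')"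
          using card_Diff_subset_Int[of h' h] finite_copy[OF h'] card_copy[OF h'] by (simp add: Int_commute)
        moreover have "h' - h \<subseteq> E" using copy_subset[OF h'] by auto
        ultimately show "(\<Sum>G\<in>Pow E. weight E p G * of_bool (h' - h \<subseteq> G)) = p ^ (m - card (h \<inter> h'))"
          by (simp only: sum_weight_contains[OF finite_complete_edges])
      qed
      finally show ?thesis .
    qed
    thus ?thesis by (simp add: joint_mean_def)
  qed
  finally show ?thesis by (simp add: algebra_simps)
qed

text \<open>
  The probability that the observed graph contains a copy besides the planted one. For graphs of
  bounded size it is comparable to the error, and unlike the error it is easily tracked when the
  noise is thinned.
\<close>

definition ambiguity :: "real \<Rightarrow> real" where
  "ambiguity p = joint_mean p (\<lambda>h y. of_bool (\<exists>h'\<in>inside y. h' \<noteq> h))"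

lemma ambiguity_nonneg: "0 \<le> p \<Longrightarrow> p \<le> 1 \<Longrightarrow> 0 \<le> ambiguity p"
  using joint_mean_mono[of p "\<lambda>_ _. 0" "\<lambda>h y. of_bool (\<exists>h'\<in>inside y. h' \<noteq> h)"]
  by (simp add: ambiguity_def joint_mean_const)

lemma MMSE_le_ambiguity:
  assumes p: "0 \<le> p" "p \<le> 1"
  shows "MMSE n H p \<le> m * ambiguity p"
  unfolding ambiguity_def MMSE_eq[OF p] joint_mean_cmult[symmetric]
proof (rule joint_mean_mono[OF p])
  fix h G assume h: "h \<in> C"
  show "m - replica_overlap h (h \<union> G) \<le> real m * of_bool (\<exists>h'\<in>inside (h \<union> G). h' \<noteq> h)"
  proof (cases "\<exists>h'\<in>inside (h \<union> G). h' \<noteq> h")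
    case True
    thus ?thesis by (simp add: replica_overlap_nonneg)
  next
    case False
    hence "inside (h \<union> G) = {h}" using inside_self[OF h] by auto
    thus ?thesis using card_copy[OF h] by (simp add: replica_overlap_def)
  qed
qed

text \<open>
  With \<open>X \<ge> 2\<close> copies present, the replica differs from the planted copy with probability
  \<open>1 - 1/X \<ge> 1/2\<close>, and it then misses at least one edge.
\<close>

lemma ambiguity_le_MMSE:
  assumes p: "0 \<le> p" "p \<le> 1"
  shows "ambiguity p \<le> 2 * MMSE n H p"
  unfolding ambiguity_def MMSE_eq[OF p] joint_mean_cmult[symmetric]
proof (rule joint_mean_mono[OF p])
  fix h G assume h: "h \<in> C"
  define y where "y = h \<union> G"
  have hy: "h \<in> inside y" using inside_self[OF h] by (simp add: y_def)
  have "of_bool (\<exists>h'\<in>inside y. h' \<noteq> h) \<le> 2 * (m - replica_overlap h y)"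
  proof (cases "\<exists>h'\<in>inside y. h' \<noteq> h")
    case False
    thus ?thesis using replica_overlap_le[OF hy] by simp
  next
    case True
    define X where "X = card (inside y)"
    obtain h' where "h' \<in> inside y" "h' \<noteq> h" using True by auto
    hence X: "2 \<le> X" using card_mono[of "inside y" "{h, h'}"] hy by (simp add: X_def)
    have "X - 1 = (\<Sum>h'\<in>inside y - {h}. 1 :: real)"
      using hy X by (simp add: X_def of_nat_diff)
    also have "\<dots> \<le> (\<Sum>h'\<in>inside y - {h}. real m - card (h \<inter> h'))"
    proof (rule sum_mono)
      fix h' assume "h' \<in> inside y - {h}"
      hence "card (h \<inter> h') < m" by (intro card_Int_copies_less h) (auto simp: inside_def)
      thus "1 \<le> real m - card (h \<inter> h')" by linarith
    qed
    also have "\<dots> \<le> (\<Sum>h'\<in>inside y. real m - card (h \<inter> h'))"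
      by (rule sum_mono2) (use h card_copy[OF h] in \<open>auto simp: card_Int_copies_le\<close>)
    finally have "(real X - 1) / X \<le> m - replica_overlap h y"
      unfolding error_as_sum[OF hy] X_def by (intro divide_right_mono) auto
    moreover have "1 / 2 \<le> (real X - 1) / X" using X by (simp add: field_simps)
    ultimately have "1 / 2 \<le> m - replica_overlap h y" by linarith
    thus ?thesis using True by simp
  qed
  thus "of_bool (\<exists>h'\<in>inside (h \<union> G). h' \<noteq> h) \<le> 2 * (m - replica_overlap h (h \<union> G))"
    by (simp add: y_def)
qed

text \<open>
  The planted copy is unaffected by thinning the noise, and a second copy survives if its at most \<open>m\<close>
  noise edges do.
\<close>

lemma ambiguity_thinning:
  assumes p: "0 \<le> p" "p \<le> 1" and r: "0 \<le> r" "r \<le> 1"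
  shows "r ^ m * ambiguity p \<le> ambiguity (r * p)"
proof -
  define A where "A h G = (\<exists>h'\<in>inside (h \<union> G). h' \<noteq> h)" for h G
  have "r ^ m * (\<Sum>G\<in>Pow E. weight E p G * of_bool (A h G)) \<le> (\<Sum>T\<in>Pow E. weight E (r * p) T * of_bool (A h T))"
    if h: "h \<in> C" for h
  proof -
    have "r ^ m * (\<Sum>G\<in>Pow E. weight E p G * of_bool (A h G))
        = (\<Sum>G\<in>Pow E. weight E p G * (r ^ m * of_bool (A h G)))"
      by (simp only: sum_distrib_left mult_ac)
    also have "\<dots> \<le> (\<Sum>G\<in>Pow E. weight E p G * (\<Sum>T\<in>Pow G. weight G r T * of_bool (A h T)))"
    proof (intro sum_mono mult_left_mono weight_nonneg p)
      fix G assume "G \<in> Pow E"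
      hence finG: "finite G" using finite_complete_edges finite_subset by blast
      show "r ^ m * of_bool (A h G) \<le> (\<Sum>T\<in>Pow G. weight G r T * of_bool (A h T))"
      proof (cases "A h G")
        case False
        thus ?thesis using weight_nonneg[OF r] by (auto intro!: sum_nonneg)
      next
        case True
        then obtain h' where h': "h' \<in> C" "h' \<subseteq> h \<union> G" "h' \<noteq> h"
          by (auto simp: A_def inside_def)
        have "r ^ m \<le> r ^ card (h' - h)"
          using card_mono[of h' "h' - h"] card_copy[OF h'(1)] finite_copy[OF h'(1)] r
          by (intro power_decreasing) auto
        also have "\<dots> = (\<Sum>T\<in>Pow G. weight G r T * of_bool (h' - h \<subseteq> T))"
          using h' finG by (subst sum_weight_contains) auto
        also have "\<dots> \<le> (\<Sum>T\<in>Pow G. weight G r T * of_bool (A h T))"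
          using h' by (intro sum_mono mult_left_mono weight_nonneg r) (auto simp: A_def inside_def)
        finally show ?thesis using True by simp
      qed
    qed
    also have "\<dots> = (\<Sum>T\<in>Pow E. weight E (r * p) T * of_bool (A h T))"
      by (rule sum_weight_thinning[symmetric]) simp
    finally show ?thesis .
  qed
  thus ?thesis
    unfolding ambiguity_def joint_mean_def A_def times_divide_eq_right sum_distrib_left[of "r ^ m" _ C]
    by (intro divide_right_mono sum_mono) auto
qed

lemma ambiguity_1:
  assumes "2 \<le> card C"
  shows "ambiguity 1 = 1"
proof -
  have "(\<Sum>G\<in>Pow E. weight E 1 G * of_bool (\<exists>h'\<in>inside (h \<union> G). h' \<noteq> h)) = 1" if h: "h \<in> C" for h
  proof -
    have "\<not> C \<subseteq> {h}"
      using assms card_mono[of "{h}" C] by auto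
    then obtain h' where "h' \<in> C" "h' \<noteq> h" by auto
    hence A: "\<exists>h'\<in>inside (h \<union> E). h' \<noteq> h" using copy_subset[of h'] by (auto simp: inside_def)
    have "(\<Sum>G\<in>Pow E. weight E 1 G * of_bool (\<exists>h'\<in>inside (h \<union> G). h' \<noteq> h))
        = (\<Sum>G\<in>Pow E. weight E 1 G)"
    proof (intro sum.cong refl)
      fix G assume G: "G \<in> Pow E"
      show "weight E 1 G * of_bool (\<exists>h'\<in>inside (h \<union> G). h' \<noteq> h) = weight E 1 G"
      proof (cases "G = E")
        case False
        hence "E - G \<noteq> {}" using G by auto
        hence "0 < card (E - G)" by (metis card_gt_0_iff finite_Diff finite_complete_edges)
        hence "weight E 1 G = 0" unfolding weight_def by (metis diff_self mult_zero_right zero_power)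
        thus ?thesis by simp
      qed (use A in simp)
    qed
    thus ?thesis by (simp add: sum_weight)
  qed
  thus ?thesis using card_copies_pos by (simp add: ambiguity_def joint_mean_def)
qed

text \<open>
  By Bayes' rule the expected replica overlap is, up to the factor \<open>1/\<mu>\<close>, the mean of \<open>T / X\<close> under pure
  noise, where \<open>X\<close> counts the copies in the noise, \<open>\<mu>\<close> is the mean of \<open>X\<close>, and \<open>T\<close> adds up the overlaps
  of all pairs of copies present. Where \<open>X \<ge> \<mu>/2\<close> the denominator is harmless; where \<open>X < \<mu>/2\<close> the
  bound \<open>T \<le> m X\<^sup>2\<close> and the variance of \<open>X\<close> take over. Both the variance and the mean of \<open>T\<close> only see
  pairs of copies with a common edge, and these are what \<open>S\<close> counts.
\<close>

lemma MMSE_ge_second_moment: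
  fixes S :: real
  assumes p: "0 < p" "p \<le> 1"
  defines "S \<equiv> (\<Sum>h\<in>C. \<Sum>h'\<in>{h'\<in>C. h \<inter> h' \<noteq> {}}. inverse p ^ card (h \<inter> h')) / (real (card C))\<^sup>2"
  shows "m * (1 - 4 * S) \<le> MMSE n H p"
proof -
  have p0: "0 \<le> p" using p by simp
  define M where "M = real (card C)"
  define \<mu> where "\<mu> = M * p ^ m"
  define X where "X y = real (card (inside y))" for y
  define T where "T y = (\<Sum>h\<in>inside y. \<Sum>h'\<in>inside y. real (card (h \<inter> h')))" for y
  have M: "0 < M" using card_copies_pos by (simp add: M_def)
  have \<mu>: "0 < \<mu>" using M p by (simp add: \<mu>_def)
  have pair: "(\<Sum>y\<in>Pow E. weight E p y * (\<Sum>h\<in>inside y. \<Sum>h'\<in>inside y. f h h'))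
      = p ^ (2 * m) * (\<Sum>h\<in>C. \<Sum>h'\<in>C. f h h' * inverse p ^ card (h \<inter> h'))" for f :: "_ \<Rightarrow> _ \<Rightarrow> real"
  proof -
    have ins: "(\<Sum>h\<in>inside y. g h) = (\<Sum>h\<in>C. of_bool (h \<subseteq> y) * g h)" for y and g :: "_ \<Rightarrow> real"
      unfolding inside_def using finite_copies by (auto intro!: sum.mono_neutral_cong_left)
    have "(\<Sum>y\<in>Pow E. weight E p y * (\<Sum>h\<in>inside y. \<Sum>h'\<in>inside y. f h h'))
        = (\<Sum>y\<in>Pow E. \<Sum>h\<in>C. \<Sum>h'\<in>C. f h h' * (weight E p y * of_bool (h \<union> h' \<subseteq> y)))"
      unfolding ins sum_distrib_left by (intro sum.cong refl) auto
    also have "\<dots> = (\<Sum>h\<in>C. \<Sum>h'\<in>C. \<Sum>y\<in>Pow E. f h h' * (weight E p y * of_bool (h \<union> h' \<subseteq> y)))"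
      by (subst sum.swap, rule sum.cong[OF refl], rule sum.swap)
    also have "\<dots> = (\<Sum>h\<in>C. \<Sum>h'\<in>C. f h h' * p ^ card (h \<union> h'))"
      unfolding sum_distrib_left[symmetric]
      by (intro sum.cong refl arg_cong2[where f = "(*)"] sum_weight_contains)
         (use copy_subset in auto)
    also have "\<dots> = (\<Sum>h\<in>C. \<Sum>h'\<in>C. p ^ (2 * m) * (f h h' * inverse p ^ card (h \<inter> h')))"
    proof (intro sum.cong refl)
      fix h h' assume h: "h \<in> C" "h' \<in> C"
      have "card (h \<union> h') + card (h \<inter> h') = 2 * m"
        using card_Un_Int[of h h'] h finite_copy card_copy by simp
      hence "p ^ (2 * m) = p ^ card (h \<union> h') * p ^ card (h \<inter> h')" by (simp add: power_add[symmetric])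
      thus "f h h' * p ^ card (h \<union> h') = p ^ (2 * m) * (f h h' * inverse p ^ card (h \<inter> h'))"
        using p by (simp add: power_inverse)
    qed
    finally show ?thesis by (simp add: sum_distrib_left)
  qed
  have first: "(\<Sum>y\<in>Pow E. weight E p y * X y) = \<mu>"
  proof -
    have "(\<Sum>y\<in>Pow E. weight E p y * X y) = (\<Sum>y\<in>Pow E. \<Sum>h\<in>{h\<in>C. h \<subseteq> y}. weight E p y)"
      by (simp add: X_def inside_def mult.commute)
    also have "\<dots> = (\<Sum>h\<in>C. \<Sum>y\<in>{y\<in>Pow E. h \<subseteq> y}. weight E p y)"
      by (rule sum.swap_restrict) (auto simp: finite_copies)
    also have "\<dots> = (\<Sum>h\<in>C. \<Sum>y\<in>Pow E. weight E p y * of_bool (h \<subseteq> y))"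
      by (intro sum.cong refl sum.mono_neutral_cong_left) auto
    also have "\<dots> = (\<Sum>h\<in>C. p ^ m)"
      by (intro sum.cong refl) (simp only: sum_weight_contains[OF finite_complete_edges copy_subset] card_copy)
    finally show ?thesis by (simp add: \<mu>_def M_def)
  qed
  have \<mu>2: "\<mu>\<^sup>2 = M\<^sup>2 * p ^ (2 * m)"
    by (simp add: \<mu>_def power_mult_distrib power_mult[symmetric] mult.commute)
  have S: "p ^ (2 * m) * (\<Sum>h\<in>C. \<Sum>h'\<in>C. of_bool (h \<inter> h' \<noteq> {}) * inverse p ^ card (h \<inter> h')) = \<mu>\<^sup>2 * S"
  proof -
    have "(\<Sum>h'\<in>C. of_bool (h \<inter> h' \<noteq> {}) * inverse p ^ card (h \<inter> h'))
        = (\<Sum>h'\<in>{h'\<in>C. h \<inter> h' \<noteq> {}}. inverse p ^ card (h \<inter> h'))" for h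
      using finite_copies by (intro sum.mono_neutral_cong_right) auto
    thus ?thesis using M by (simp add: S_def \<mu>2 M_def)
  qed
  have var: "(\<Sum>y\<in>Pow E. weight E p y * (X y - \<mu>)\<^sup>2) \<le> \<mu>\<^sup>2 * S"
  proof -
    have "(\<Sum>y\<in>Pow E. weight E p y * (X y - \<mu>)\<^sup>2)
        = (\<Sum>y\<in>Pow E. weight E p y * (\<Sum>h\<in>inside y. \<Sum>h'\<in>inside y. 1) - 2 * \<mu> * (weight E p y * X y) + \<mu>\<^sup>2 * weight E p y)"
      by (intro sum.cong refl) (simp add: X_def power2_eq_square algebra_simps)
    also have "\<dots> = p ^ (2 * m) * (\<Sum>h\<in>C. \<Sum>h'\<in>C. inverse p ^ card (h \<inter> h')) - \<mu>\<^sup>2"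
      by (simp only: sum.distrib sum_subtractf sum_distrib_left[symmetric] first pair)
         (simp add: sum_weight power2_eq_square)
    also have "\<dots> = p ^ (2 * m) * (\<Sum>h\<in>C. \<Sum>h'\<in>C. inverse p ^ card (h \<inter> h') - 1)"
      by (simp add: sum_subtractf \<mu>2[unfolded power2_eq_square] M_def power2_eq_square algebra_simps)
    also have "\<dots> \<le> p ^ (2 * m) * (\<Sum>h\<in>C. \<Sum>h'\<in>C. of_bool (h \<inter> h' \<noteq> {}) * inverse p ^ card (h \<inter> h'))"
      using p by (intro mult_left_mono sum_mono) auto
    finally show ?thesis unfolding S .
  qed
  have T_sum: "(\<Sum>y\<in>Pow E. weight E p y * T y) \<le> m * (\<mu>\<^sup>2 * S)"
  proof -
    have "(\<Sum>y\<in>Pow E. weight E p y * T y)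
        = p ^ (2 * m) * (\<Sum>h\<in>C. \<Sum>h'\<in>C. real (card (h \<inter> h')) * inverse p ^ card (h \<inter> h'))"
      unfolding T_def pair ..
    also have "\<dots> \<le> p ^ (2 * m) * (\<Sum>h\<in>C. \<Sum>h'\<in>C. m * (of_bool (h \<inter> h' \<noteq> {}) * inverse p ^ card (h \<inter> h')))"
      using p by (intro mult_left_mono sum_mono) (auto simp: card_Int_copies_le)
    also have "\<dots> = m * (p ^ (2 * m) * (\<Sum>h\<in>C. \<Sum>h'\<in>C. of_bool (h \<inter> h' \<noteq> {}) * inverse p ^ card (h \<inter> h')))"
      by (simp add: sum_distrib_left mult_ac)
    finally show ?thesis unfolding S .
  qed
  have pointwise: "T y / X y \<le> m * (2 * (X y - \<mu>)\<^sup>2 / \<mu>) + 2 * T y / \<mu>" for y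
  proof -
    have T0: "0 \<le> T y" by (simp add: T_def sum_nonneg)
    have TX: "T y \<le> m * X y * X y"
    proof -
      have "T y \<le> (\<Sum>h\<in>inside y. \<Sum>h'\<in>inside y. real m)"
        unfolding T_def by (intro sum_mono) (auto simp: card_Int_copies_le inside_def)
      thus ?thesis by (simp add: X_def mult_ac)
    qed
    show ?thesis
    proof (cases "X y < \<mu> / 2")
      case True
      have "T y / X y \<le> m * X y" using TX by (cases "X y = 0") (auto simp: X_def divide_simps)
      also have "\<dots> \<le> m * (2 * (X y - \<mu>)\<^sup>2 / \<mu>)"
      proof (rule mult_left_mono)
        have "(\<mu> / 2)\<^sup>2 \<le> (\<mu> - X y)\<^sup>2" using True \<mu> by (intro power_mono) auto
        hence "\<mu>\<^sup>2 \<le> 4 * (X y - \<mu>)\<^sup>2" by (simp add: power2_commute power_divide)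
        moreover have "X y * \<mu> \<le> \<mu> / 2 * \<mu>" using True \<mu> by (intro mult_right_mono) auto
        ultimately have "X y * \<mu> \<le> 2 * (X y - \<mu>)\<^sup>2" by (simp add: power2_eq_square)
        thus "X y \<le> 2 * (X y - \<mu>)\<^sup>2 / \<mu>" using \<mu> by (simp add: pos_le_divide_eq)
      qed auto
      also have "\<dots> \<le> \<dots> + 2 * T y / \<mu>" using T0 \<mu> by simp
      finally show ?thesis .
    next
      case False
      have "T y / X y \<le> T y / (\<mu> / 2)" using False \<mu> T0 by (intro divide_left_mono) auto
      also have "\<dots> = 2 * T y / \<mu>" by simp
      also have "\<dots> \<le> m * (2 * (X y - \<mu>)\<^sup>2 / \<mu>) + \<dots>" using \<mu> by simp
      finally show ?thesis .
    qed
  qed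
  have "joint_mean p replica_overlap = (\<Sum>y\<in>Pow E. weight E p y * (T y / X y)) / \<mu>"
  proof -
    have "likelihood p y * (\<Sum>h\<in>inside y. replica_overlap h y) = weight E p y * (T y / X y) / p ^ m"
      if y: "y \<in> Pow E" for y
    proof (cases "inside y = {}")
      case True
      thus ?thesis by (simp add: T_def)
    next
      case False
      then obtain h where h: "h \<in> C" "h \<subseteq> y" by (auto simp: inside_def)
      have "finite y" using y finite_subset[OF _ finite_complete_edges] by auto
      hence "m \<le> card y" using h card_mono[of y h] card_copy by auto
      hence "weight E p y = p ^ m * likelihood p y"
        by (simp add: weight_def likelihood_def power_add[symmetric])
      moreover have "(\<Sum>h\<in>inside y. replica_overlap h y) = T y / X y"
        by (simp add: replica_overlap_def T_def X_def sum_divide_distrib)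
      ultimately show ?thesis using p by simp
    qed
    hence "joint_mean p replica_overlap = (\<Sum>y\<in>Pow E. weight E p y * (T y / X y) / p ^ m) / card C"
      unfolding joint_mean_Bayes by (intro arg_cong2[where f = "(/)"] sum.cong refl) auto
    thus ?thesis by (simp only: sum_divide_distrib[symmetric] divide_divide_eq_left \<mu>_def M_def mult.commute)
  qed
  also have "\<dots> \<le> (\<Sum>y\<in>Pow E. weight E p y * (m * (2 * (X y - \<mu>)\<^sup>2 / \<mu>) + 2 * T y / \<mu>)) / \<mu>"
    using \<mu> p0 p by (intro divide_right_mono sum_mono mult_left_mono pointwise weight_nonneg) auto
  also have "\<dots> = (2 * m / \<mu> * (\<Sum>y\<in>Pow E. weight E p y * (X y - \<mu>)\<^sup>2)
                    + 2 / \<mu> * (\<Sum>y\<in>Pow E. weight E p y * T y)) / \<mu>"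
    by (simp add: sum_distrib_left sum.distrib[symmetric] algebra_simps)
  also have "\<dots> \<le> (2 * m / \<mu> * (\<mu>\<^sup>2 * S) + 2 / \<mu> * (m * (\<mu>\<^sup>2 * S))) / \<mu>"
    using \<mu> by (intro divide_right_mono add_mono mult_left_mono var T_sum) auto
  also have "\<dots> = 4 * m * S" using \<mu> by (simp add: power2_eq_square field_simps)
  finally have "joint_mean p replica_overlap \<le> 4 * m * S" .
  moreover have "MMSE n H p = m - joint_mean p replica_overlap"
    using joint_mean_add[of p "\<lambda>_ _. real m" "\<lambda>h y. (-1) * replica_overlap h y"]
          joint_mean_cmult[of p "-1" replica_overlap]
    by (simp add: MMSE_eq[OF p0 p(2)] joint_mean_const)
  ultimately show ?thesis by (simp add: algebra_simps)
qed

end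

section \<open>Copies of a clique\<close>

text \<open>
  Planted cliques live on arbitrary vertex sets, which the edge sets \<open>complete_edges k\<close> do not cover.
\<close>

definition clique :: "nat set \<Rightarrow> nat set set" where
  "clique V = {e. e \<subseteq> V \<and> card e = 2}"

lemma complete_edges_eq_clique: "complete_edges k = clique {..<k}"
  by (simp add: complete_edges_def clique_def)

lemma card_clique: "finite V \<Longrightarrow> card (clique V) = card V choose 2"
  by (simp add: clique_def n_subsets)

lemma card_complete_edges: "card (complete_edges k) = k choose 2"
  by (simp add: complete_edges_eq_clique card_clique)

lemma clique_Int: "clique V \<inter> clique W = clique (V \<inter> W)"
  by (auto simp: clique_def)

lemma Union_clique:
  assumes "2 \<le> card V"
  shows "\<Union>(clique V) = V"
proof
  show "V \<subseteq> \<Union>(clique V)"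
  proof
    fix x assume x: "x \<in> V"
    have "\<not> V \<subseteq> {x}" using assms card_mono[of "{x}" V] by auto
    then obtain y where "y \<in> V" "y \<noteq> x" by auto
    with x have "{x, y} \<in> clique V" by (auto simp: clique_def)
    thus "x \<in> \<Union>(clique V)" by blast
  qed
qed (auto simp: clique_def)

lemma image_clique:
  assumes "inj_on f V"
  shows "(\<lambda>e. f ` e) ` clique V = clique (f ` V)"
proof
  show "(\<lambda>e. f ` e) ` clique V \<subseteq> clique (f ` V)"
    using assms by (auto simp: clique_def card_image inj_on_subset)
  show "clique (f ` V) \<subseteq> (\<lambda>e. f ` e) ` clique V"
  proof
    fix e assume e: "e \<in> clique (f ` V)"
    then obtain d where d: "d \<subseteq> V" "e = f ` d" by (auto simp: clique_def elim: subset_imageE)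
    have "card d = card e" using d assms by (simp add: card_image inj_on_subset)
    thus "e \<in> (\<lambda>e. f ` e) ` clique V" using d e by (auto simp: clique_def)
  qed
qed

definition ksets :: "nat \<Rightarrow> nat \<Rightarrow> nat set set" where
  "ksets n k = {V. V \<subseteq> {..<n} \<and> card V = k}"

lemma finite_ksets: "finite (ksets n k)"
  by (rule finite_subset[of _ "Pow {..<n}"]) (auto simp: ksets_def)

lemma copies_complete:
  assumes "2 \<le> k"
  shows "copies n (complete_edges k) = clique ` ksets n k"
proof -
  have U: "\<Union>(clique {..<k}) = {..<k}"
    using Union_clique[of "{..<k}"] assms by simp
  show ?thesis
  proof
    show "copies n (complete_edges k) \<subseteq> clique ` ksets n k"
      by (auto simp: copies_def U complete_edges_eq_clique image_clique ksets_def card_image)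
    show "clique ` ksets n k \<subseteq> copies n (complete_edges k)"
    proof
      fix h assume "h \<in> clique ` ksets n k"
      then obtain V where V: "V \<subseteq> {..<n}" "card V = k" "h = clique V" by (auto simp: ksets_def)
      have "finite V" using V finite_subset by auto
      then obtain f where "bij_betw f {..<k} V"
        using ex_bij_betw_nat_finite[of V] V by (auto simp: atLeast0LessThan)
      hence f: "inj_on f {..<k}" "f ` {..<k} = V" by (auto simp: bij_betw_def)
      hence "h = (\<lambda>e. f ` e) ` clique {..<k}" by (simp add: image_clique V)
      thus "h \<in> copies n (complete_edges k)"
        unfolding copies_def complete_edges_eq_clique U using f V by blast
    qed
  qed
qed

lemma inj_on_clique: "2 \<le> k \<Longrightarrow> inj_on clique (ksets n k)"
  by (rule inj_on_inverseI[of _ Union]) (simp add: ksets_def Union_clique)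

lemma card_copies_complete: "2 \<le> k \<Longrightarrow> card (copies n (complete_edges k)) = n choose k"
  using n_subsets[of "{..<n}" k]
  by (simp add: copies_complete card_image inj_on_clique) (simp add: ksets_def)

lemma planted_graph_complete:
  assumes "2 \<le> k" "k \<le> n"
  shows "planted_graph n (complete_edges k)"
proof
  show "copies n (complete_edges k) \<noteq> {}"
    using card_copies_complete[OF assms(1), of n] assms(2) by auto
qed (auto simp: complete_edges_def)

text \<open>
  The exact count is \<open>(k choose l) * (n - k choose (k - l))\<close>. The weaker bound has the advantage that
  \<open>(n choose l)\<close> can be compared directly with a power of \<open>(n choose k)\<close>.
\<close>

lemma card_ksets_Int_le:
  assumes V: "V \<in> ksets n k" and l: "l \<le> k"
  shows "real (card {W \<in> ksets n k. card (V \<inter> W) = l})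
       \<le> real (n choose k) * ((real (k choose l))\<^sup>2 / real (n choose l))"
proof -
  have VD: "V \<subseteq> {..<n}" "card V = k" using V by (auto simp: ksets_def)
  have finV: "finite V" using VD finite_subset by auto
  have kn: "k \<le> n" using card_mono[of "{..<n}" V] VD by simp
  let ?A = "{S. S \<subseteq> V \<and> card S = l}" and ?B = "{T. T \<subseteq> {..<n} - V \<and> card T = k - l}"
  have "card {W \<in> ksets n k. card (V \<inter> W) = l} \<le> card (?A \<times> ?B)"
  proof (rule card_inj_on_le)
    show "inj_on (\<lambda>W. (V \<inter> W, W - V)) {W \<in> ksets n k. card (V \<inter> W) = l}"
      by (rule inj_on_inverseI[of _ "\<lambda>(S, T). S \<union> T"]) auto
    show "(\<lambda>W. (V \<inter> W, W - V)) ` {W \<in> ksets n k. card (V \<inter> W) = l} \<subseteq> ?A \<times> ?B"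
      using finV by (auto simp: ksets_def card_Diff_subset_Int Int_commute finite_subset)
    show "finite (?A \<times> ?B)"
      using finV by (intro finite_cartesian_product) auto
  qed
  also have "\<dots> = (k choose l) * ((n - k) choose (k - l))"
    using finV VD by (simp add: card_cartesian_product n_subsets card_Diff_subset)
  also have "\<dots> \<le> (k choose l) * ((n - l) choose (k - l))"
    using l by (intro mult_left_mono binomial_right_mono) auto
  finally have "real (card {W \<in> ksets n k. card (V \<inter> W) = l}) \<le> real ((k choose l) * ((n - l) choose (k - l)))"
    by (rule of_nat_mono)
  also have "\<dots> = real (n choose k) * ((real (k choose l))\<^sup>2 / real (n choose l))"
  proof -
    have "(n choose k) * (k choose l) = (n choose l) * ((n - l) choose (k - l))"
      using l kn by (rule choose_mult)
    hence "real (n choose k) * real (k choose l) = real (n choose l) * real ((n - l) choose (k - l))"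
      by (simp only: of_nat_mult[symmetric])
    moreover have "0 < n choose l" using l kn by simp
    ultimately show ?thesis by (simp add: field_simps power2_eq_square)
  qed
  finally show ?thesis .
qed

lemma sum_clique_overlaps_le:
  fixes F :: "nat \<Rightarrow> real"
  assumes k: "2 \<le> k" "k \<le> n" and F: "\<And>j. 0 \<le> F j"
  defines "C \<equiv> copies n (complete_edges k)"
  shows "(\<Sum>h\<in>C. \<Sum>h'\<in>C. F (card (h \<inter> h'))) / (real (n choose k))\<^sup>2
       \<le> (\<Sum>l\<le>k. (real (k choose l))\<^sup>2 / real (n choose l) * F (l choose 2))"
proof -
  let ?M = "real (n choose k)"
  let ?R = "\<Sum>l\<le>k. (real (k choose l))\<^sup>2 / real (n choose l) * F (l choose 2)"
  have fin: "finite V" if "V \<in> ksets n k" for V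
    using that finite_subset by (auto simp: ksets_def)
  have "(\<Sum>W\<in>ksets n k. F (card (V \<inter> W) choose 2)) \<le> ?M * ?R" if V: "V \<in> ksets n k" for V
  proof -
    have "(\<Sum>W\<in>ksets n k. F (card (V \<inter> W) choose 2))
        = (\<Sum>l\<le>k. \<Sum>W\<in>{W \<in> ksets n k. card (V \<inter> W) = l}. F (card (V \<inter> W) choose 2))"
    proof (rule sum.group[symmetric])
      show "(\<lambda>W. card (V \<inter> W)) ` ksets n k \<subseteq> {..k}"
        using card_mono[of V] fin[OF V] V by (auto simp: ksets_def)
    qed (auto simp: finite_ksets)
    also have "\<dots> = (\<Sum>l\<le>k. real (card {W \<in> ksets n k. card (V \<inter> W) = l}) * F (l choose 2))"
      by (intro sum.cong refl) simp
    also have "\<dots> \<le> (\<Sum>l\<le>k. ?M * ((real (k choose l))\<^sup>2 / real (n choose l)) * F (l choose 2))"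
      by (intro sum_mono mult_right_mono card_ksets_Int_le V F) auto
    finally show ?thesis by (simp add: sum_distrib_left mult.assoc)
  qed
  hence "(\<Sum>V\<in>ksets n k. \<Sum>W\<in>ksets n k. F (card (V \<inter> W) choose 2)) \<le> (\<Sum>V\<in>ksets n k. ?M * ?R)"
    by (rule sum_mono)
  also have "\<dots> = ?M\<^sup>2 * ?R"
    using n_subsets[of "{..<n}" k] by (simp add: ksets_def power2_eq_square)
  also have "(\<Sum>V\<in>ksets n k. \<Sum>W\<in>ksets n k. F (card (V \<inter> W) choose 2))
      = (\<Sum>h\<in>C. \<Sum>h'\<in>C. F (card (h \<inter> h')))"
    unfolding C_def copies_complete[OF k(1)] sum.reindex[OF inj_on_clique[OF k(1)]] o_def clique_Int
    by (intro sum.cong refl) (simp add: card_clique fin)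
  finally show ?thesis using k by (simp add: divide_simps mult.commute)
qed

section \<open>Binomial estimates\<close>

lemma binomial_le_exp_power:
  assumes "1 \<le> k"
  shows "real (n choose k) \<le> (exp 1 * n / k) ^ k"
proof -
  have "real k ^ k / fact k \<le> exp (real k)"
  proof -
    have "(\<Sum>i\<in>{k}. real k ^ i /\<^sub>R fact i) \<le> (\<Sum>i. real k ^ i /\<^sub>R fact i)"
      by (rule sum_le_suminf) (use summable_exp[of "real k"] in \<open>auto simp: mult.commute\<close>)
    thus ?thesis by (simp add: exp_def divide_inverse mult.commute)
  qed
  also have "exp (real k) = exp 1 ^ k" by (simp add: exp_of_nat_mult[symmetric])
  finally have *: "real k ^ k \<le> exp 1 ^ k * fact k" by (simp add: pos_divide_le_eq)
  have "real ((n choose k) * fact k) \<le> real (n ^ k)"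
    by (rule of_nat_mono) (rule binomial_fact_pow)
  hence "real (n choose k) * fact k \<le> real n ^ k" by simp
  hence "real (n choose k) * fact k * real k ^ k \<le> real n ^ k * (exp 1 ^ k * fact k)"
    using * by (intro mult_mono) auto
  hence "real (n choose k) * real k ^ k \<le> real n ^ k * exp 1 ^ k"
    by (simp add: mult_ac)
  thus ?thesis using assms by (simp add: power_divide power_mult_distrib pos_le_divide_eq mult.commute)
qed

lemma choose_two_real: "real (k choose 2) = real k * (real k - 1) / 2"
proof -
  have "even (k * (k - 1))" by (cases k) auto
  thus ?thesis by (cases k) (auto simp: choose_two real_of_nat_div algebra_simps)
qed

text \<open>
  Up to the factor \<open>(k choose l)\<^sup>2\<close>, the left-hand side bounds the expected number of cliques that have
  \<open>l\<close> vertices in common with the planted one when \<open>p\<close> is exactly \<open>p1M\<close>. With \<open>x = (l - 1) / (k - 1)\<close> the exponent is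
  \<open>l x / k\<close>, so the numerator is at most \<open>(exp 1 * n / k) powr (l x)\<close>, whereas the denominator is at
  least \<open>(n / k) ^ l\<close>.
\<close>

lemma binomial_powr_ratio_le:
  assumes l: "1 \<le> l" "l \<le> k" and k: "2 \<le> k" "k \<le> n"
  shows "real (n choose k) powr (real (l choose 2) / real (k choose 2)) / real (n choose l)
       \<le> exp l * (real k / n) powr (l * (1 - (real l - 1) / (real k - 1)))"
proof -
  define x where "x = (real l - 1) / (real k - 1)"
  define b where "b = real n / k"
  have x: "0 \<le> x" "x \<le> 1" using l k by (auto simp: x_def)
  have b: "1 \<le> b" using k by (simp add: b_def)
  have ratio: "real (l choose 2) / real (k choose 2) = l / k * x"
    using k l by (simp add: choose_two_real x_def field_simps)
  have "real (n choose k) powr (l / k * x) \<le> ((exp 1 * b) ^ k) powr (l / k * x)"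
    using binomial_le_exp_power[of k n] k x by (intro powr_mono2) (auto simp: b_def)
  also have "\<dots> = (exp 1 * b) powr (l * x)"
    using k b by (simp add: powr_realpow[symmetric] powr_powr)
  also have "\<dots> = exp (l * x) * b powr (l * x)"
    using b by (simp add: powr_mult exp_powr_real)
  also have "\<dots> \<le> exp l * b powr (l * x)"
    using x by (intro mult_right_mono) (auto simp: mult_left_le)
  finally have up: "real (n choose k) powr (l / k * x) \<le> exp l * b powr (l * x)" .
  have "b ^ l \<le> (real n / l) ^ l"
    unfolding b_def using l k by (intro power_mono divide_left_mono) auto
  also have "\<dots> \<le> real (n choose l)"
    using binomial_ge_n_over_k_pow_k[of l n, where ?'a = real] l k by simp
  finally have low: "b ^ l \<le> real (n choose l)" .
  have "real (n choose k) powr (l / k * x) / real (n choose l) \<le> exp l * b powr (l * x) / b ^ l"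
    using up low b by (intro frac_le) auto
  also have "\<dots> = exp l * (b powr (l * x) / b powr l)"
    using b by (simp add: powr_realpow)
  also have "b powr (l * x) / b powr l = (1 / b) powr (l * (1 - x))"
    using b by (simp add: powr_divide powr_diff[symmetric] powr_minus[symmetric] inverse_eq_divide[symmetric] inverse_powr algebra_simps)
  finally show ?thesis by (simp add: ratio b_def x_def)
qed

lemma binomial_powr_ratio_le_exp:
  assumes l: "l \<le> k" and k: "2 \<le> k" "k \<le> n"
  shows "real (n choose k) powr (real (l choose 2) / real (k choose 2)) / real (n choose l) \<le> exp l"
proof (cases "l = 0")
  case True
  thus ?thesis using k by (simp add: choose_two)
next
  case False
  have "(real k / n) powr (l * (1 - (real l - 1) / (real k - 1))) \<le> 1"
    using False l k by (intro powr_le1) (auto simp: divide_simps)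
  hence "exp l * (real k / n) powr (l * (1 - (real l - 1) / (real k - 1))) \<le> exp l" by simp
  thus ?thesis using binomial_powr_ratio_le[of l k n] False l k by linarith
qed

section \<open>Error bounds for planted cliques\<close>

lemma p1M_complete:
  "2 \<le> k \<Longrightarrow> p1M n (complete_edges k) = real (n choose k) powr (- 1 / real (k choose 2))"
  by (simp add: p1M_def card_copies_complete card_complete_edges)

lemma p1M_bounds: "p1M n H \<in> {0..1}"
proof (cases "card (copies n H) = 0")
  case False
  hence "real (card (copies n H)) powr (- 1 / real (card H)) \<le> real (card (copies n H)) powr 0"
    by (intro powr_mono) auto
  thus ?thesis using False by (simp add: p1M_def)
qed (simp add: p1M_def)

text \<open>
  At \<open>p = (1 - \<epsilon>) p1M\<close> the expected number of cliques in the observed graph with \<open>l\<close> common vertices is at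
  most \<open>(k choose l)\<^sup>2 * M powr (j / m) / (n choose l) * (1 - \<epsilon>) ^ (m - j)\<close> with \<open>j = (l choose 2)\<close>. The
  first factor is at most \<open>4 ^ k\<close>, the quotient at most \<open>exp k\<close>, and for far cliques \<open>m - j \<ge> \<delta> m\<close>.
\<close>

lemma MMSE_clique_le:
  assumes k: "2 \<le> k" "k \<le> n" and \<epsilon>: "0 < \<epsilon>" "\<epsilon> < 1" and \<delta>: "0 \<le> \<delta>"
    and p: "0 \<le> p" "p \<le> (1 - \<epsilon>) * p1M n (complete_edges k)"
  shows "MMSE n (complete_edges k) p / real (k choose 2)
       \<le> \<delta> + (real k + 1) * ((4 * exp 1) ^ k * (1 - \<epsilon>) powr (\<delta> * real (k choose 2)))"
proof -
  interpret planted_graph n "complete_edges k" by (rule planted_graph_complete[OF k])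
  define m where "m = k choose 2"
  define M where "M = real (n choose k)"
  define q where "q = M powr (- 1 / m)"
  define F where "F j = of_bool (real j < (1 - \<delta>) * m) * p ^ (m - j)" for j
  let ?b = "(4 * exp 1) ^ k * (1 - \<epsilon>) powr (\<delta> * m)"
  have M: "1 \<le> M" using k by (simp add: M_def Suc_leI)
  have m: "0 < m" using k by (simp add: m_def)
  have q: "q = p1M n (complete_edges k)" by (simp add: q_def M_def m_def p1M_complete k)
  have p1: "p \<le> 1"
  proof -
    have "(1 - \<epsilon>) * q \<le> 1 * 1" using p1M_bounds[of n "complete_edges k"] \<epsilon> q by (intro mult_mono) auto
    thus ?thesis using p q by simp
  qed
  have summand: "(real (k choose l))\<^sup>2 / real (n choose l) * (M * F (l choose 2)) \<le> ?b" if l: "l \<le> k" for l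
  proof (cases "real (l choose 2) < (1 - \<delta>) * m")
    case False
    thus ?thesis using \<epsilon> by (simp add: F_def)
  next
    case True
    define j where "j = l choose 2"
    have j: "real j < (1 - \<delta>) * m" using True by (simp add: j_def)
    moreover have "(1 - \<delta>) * m \<le> 1 * real m" using \<delta> by (intro mult_right_mono) auto
    ultimately have jm: "j \<le> m" by linarith
    have "p ^ (m - j) \<le> ((1 - \<epsilon>) * q) ^ (m - j)" using p q by (intro power_mono) auto
    also have "\<dots> = (1 - \<epsilon>) powr (real m - j) * M powr (- (real m - j) / m)"
    proof -
      have "(1 - \<epsilon>) ^ (m - j) = (1 - \<epsilon>) powr (real m - j)"
        using \<epsilon> jm by (simp add: powr_realpow[symmetric] of_nat_diff)
      moreover have "q ^ (m - j) = M powr (- (real m - j) / m)"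
      proof -
        have "q ^ (m - j) = q powr (real m - j)"
          using M jm by (simp add: q_def powr_realpow[symmetric] of_nat_diff)
        also have "\<dots> = M powr (- 1 / m * (real m - j))" unfolding q_def by (rule powr_powr)
        also have "- 1 / m * (real m - j) = - (real m - j) / m" using m by (simp add: field_simps)
        finally show ?thesis .
      qed
      ultimately show ?thesis by (simp only: power_mult_distrib)
    qed
    also have "M powr (- (real m - j) / m) = M powr (j / m) / M"
    proof -
      have "- (real m - j) / m = j / m - 1" using m by (simp add: field_simps)
      thus ?thesis using M by (simp only: powr_diff) simp
    qed
    also have "(1 - \<epsilon>) powr (real m - j) \<le> (1 - \<epsilon>) powr (\<delta> * m)"
      using \<epsilon> j by (intro powr_mono') (auto simp: algebra_simps)
    finally have "p ^ (m - j) \<le> (1 - \<epsilon>) powr (\<delta> * m) * (M powr (j / m) / M)"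
      using M by (simp add: mult_right_mono divide_right_mono)
    hence F: "M * F j \<le> (1 - \<epsilon>) powr (\<delta> * m) * M powr (j / m)"
      using M j by (simp add: F_def field_simps)
    have "real (k choose l) \<le> 2 ^ k"
      using binomial_le_pow2[of k l] by (metis of_nat_le_iff of_nat_numeral of_nat_power)
    hence "(real (k choose l))\<^sup>2 \<le> (2 ^ k)\<^sup>2" by (intro power_mono) auto
    hence "(real (k choose l))\<^sup>2 \<le> 4 ^ k" by (simp add: power_mult[symmetric] power_mult_distrib[symmetric] power2_eq_square)
    moreover have "M powr (j / m) / real (n choose l) \<le> exp 1 ^ k"
    proof -
      have "M powr (j / m) / real (n choose l) \<le> exp l"
        unfolding M_def j_def m_def by (rule binomial_powr_ratio_le_exp[OF l k])
      also have "\<dots> \<le> exp 1 ^ k" using l by (simp add: exp_of_nat_mult[symmetric])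
      finally show ?thesis .
    qed
    ultimately have "(real (k choose l))\<^sup>2 * (M powr (j / m) / real (n choose l)) \<le> 4 ^ k * exp 1 ^ k"
      by (intro mult_mono) auto
    hence "(1 - \<epsilon>) powr (\<delta> * m) * ((real (k choose l))\<^sup>2 * (M powr (j / m) / real (n choose l)))
        \<le> (1 - \<epsilon>) powr (\<delta> * m) * (4 ^ k * exp 1 ^ k)"
      by (intro mult_left_mono) auto
    moreover have "(real (k choose l))\<^sup>2 / real (n choose l) * (M * F j)
        \<le> (real (k choose l))\<^sup>2 / real (n choose l) * ((1 - \<epsilon>) powr (\<delta> * m) * M powr (j / m))"
      by (intro mult_left_mono F) auto
    ultimately show ?thesis by (simp add: j_def power_mult_distrib mult_ac)
  qed
  have card: "card C = n choose k" "card (complete_edges k) = m"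
    by (simp_all add: card_copies_complete card_complete_edges k m_def)
  have "(\<Sum>h\<in>C. \<Sum>h'\<in>{h'\<in>C. card (h \<inter> h') < (1 - \<delta>) * m}. p ^ (m - card (h \<inter> h'))) / card C
      = M * ((\<Sum>h\<in>C. \<Sum>h'\<in>C. F (card (h \<inter> h'))) / M\<^sup>2)"
  proof -
    have "(\<Sum>h'\<in>{h'\<in>C. card (h \<inter> h') < (1 - \<delta>) * m}. p ^ (m - card (h \<inter> h')))
        = (\<Sum>h'\<in>C. F (card (h \<inter> h')))" for h
      using finite_copies by (intro sum.mono_neutral_cong_left) (auto simp: F_def)
    thus ?thesis using M by (simp add: card M_def power2_eq_square)
  qed
  also have "\<dots> \<le> M * (\<Sum>l\<le>k. (real (k choose l))\<^sup>2 / real (n choose l) * F (l choose 2))"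
    unfolding M_def using p by (intro mult_left_mono sum_clique_overlaps_le k) (auto simp: F_def)
  also have "\<dots> = (\<Sum>l\<le>k. (real (k choose l))\<^sup>2 / real (n choose l) * (M * F (l choose 2)))"
    by (simp add: sum_distrib_left mult_ac)
  also have "\<dots> \<le> (\<Sum>l\<le>k. ?b)"
    by (intro sum_mono summand) auto
  also have "\<dots> = (real k + 1) * ?b" by simp
  finally have "m * (\<delta> + (\<Sum>h\<in>C. \<Sum>h'\<in>{h'\<in>C. card (h \<inter> h') < (1 - \<delta>) * m}. p ^ (m - card (h \<inter> h'))) / card C)
      \<le> m * (\<delta> + (real k + 1) * ?b)"
    by (intro mult_left_mono add_left_mono) auto
  hence "MMSE n (complete_edges k) p \<le> m * (\<delta> + (real k + 1) * ?b)"
    using MMSE_le_far_copies[OF p(1) p1 \<delta>] unfolding card by linarith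
  thus ?thesis using m by (simp add: pos_divide_le_eq m_def mult.commute)
qed

text \<open>
  The pairs of cliques are split according to the number \<open>l\<close> of common vertices. If \<open>l - 1\<close> is at most
  half of \<open>k - 1\<close>, the contribution is at most \<open>a ^ l\<close>, because \<open>k / n\<close> is exponentially small in \<open>k\<close>. For
  larger \<open>l\<close> the overlap has at least \<open>(k - 1)\<^sup>2 / 8\<close> edges, each contributing a factor \<open>1 / (1 + \<epsilon>)\<close>,
  and this gives \<open>b\<close>.
\<close>

lemma MMSE_clique_ge:
  fixes \<epsilon> :: real
  assumes k: "2 \<le> k" "k \<le> n" and \<epsilon>: "0 < \<epsilon>"
    and p: "(1 + \<epsilon>) * p1M n (complete_edges k) \<le> p" "p \<le> 1"
  defines "a \<equiv> real k ^ 2 * exp 2 * (1 + \<epsilon>) powr (- (real k - 1) / 4)"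
  defines "b \<equiv> (4 * exp 1) ^ k * (1 + \<epsilon>) powr (- (real k - 1)\<^sup>2 / 8)"
  assumes a1: "a \<le> 1"
  shows "1 - 4 * ((real k + 1) * (a + b)) \<le> MMSE n (complete_edges k) p / real (k choose 2)"
proof -
  interpret planted_graph n "complete_edges k" by (rule planted_graph_complete[OF k])
  define m where "m = k choose 2"
  define M where "M = real (n choose k)"
  define q where "q = M powr (- 1 / m)"
  define F where "F j = of_bool (j \<noteq> 0) * inverse p ^ j" for j
  have M: "1 \<le> M" using k by (simp add: M_def Suc_leI)
  have m: "0 < m" using k by (simp add: m_def)
  have q: "q = p1M n (complete_edges k)" by (simp add: q_def M_def m_def p1M_complete k)
  have q0: "0 < q" using M by (simp add: q_def)
  have qp: "(1 + \<epsilon>) * q \<le> p" using p q by simp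
  have p0: "0 < p" using mult_pos_pos[of "1 + \<epsilon>" q] qp q0 \<epsilon> by linarith
  have a0: "0 \<le> a" by (simp add: a_def)
  have b0: "0 \<le> b" by (simp add: b_def)
  \<comment> \<open>The threshold exceeds \<open>1 / (1 + \<epsilon>)\<close> unless \<open>M \<ge> (1 + \<epsilon>) ^ m\<close>, and \<open>M \<le> (exp 1 * n / k) ^ k\<close>.\<close>
  have kn: "real k / n \<le> exp 1 * (1 + \<epsilon>) powr (- (real k - 1) / 2)"
  proof -
    have "1 + \<epsilon> \<le> M powr (1 / m)"
      using order_trans[OF qp p(2)] M by (simp add: q_def powr_minus_divide pos_divide_le_eq)
    hence "(1 + \<epsilon>) powr m \<le> (M powr (1 / m)) powr m" using \<epsilon> by (intro powr_mono2) auto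
    also have "\<dots> = M" using M m by (simp add: powr_powr)
    also have "\<dots> \<le> (exp 1 * n / k) ^ k" unfolding M_def using k by (intro binomial_le_exp_power) auto
    also have "\<dots> = (exp 1 * n / k) powr k" using k by (simp add: powr_realpow)
    finally have "((1 + \<epsilon>) powr m) powr (1 / k) \<le> ((exp 1 * n / k) powr k) powr (1 / k)"
      by (intro powr_mono2) auto
    moreover have "real m / k = (real k - 1) / 2"
      using k by (simp add: m_def choose_two_real)
    ultimately have "(1 + \<epsilon>) powr ((real k - 1) / 2) \<le> exp 1 * n / k"
      using k by (simp add: powr_powr del: divide_divide_eq_left')
    moreover have "(1 + \<epsilon>) powr (- (real k - 1) / 2) = inverse ((1 + \<epsilon>) powr ((real k - 1) / 2))"
      by (metis minus_divide_left powr_minus)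
    moreover have "0 < (1 + \<epsilon>) powr ((real k - 1) / 2)" using \<epsilon> by simp
    moreover have "real k / n \<le> exp 1 * inverse A" if "A \<le> exp 1 * n / k" "0 < A" for A
      using that k by (simp add: field_simps)
    ultimately show ?thesis by simp
  qed
  have summand: "(real (k choose l))\<^sup>2 / real (n choose l) * F (l choose 2) \<le> a + b" if l: "l \<le> k" for l
  proof (cases "l choose 2 = 0")
    case True
    thus ?thesis using a0 b0 by (simp add: F_def)
  next
    case False
    hence l2: "2 \<le> l" by (metis binomial_eq_0 not_le)
    define j where "j = l choose 2"
    have jreal: "real j = real l * (real l - 1) / 2" by (simp add: j_def choose_two_real)
    have "inverse p ^ j \<le> inverse ((1 + \<epsilon>) * q) ^ j"
      using qp q0 \<epsilon> p0 by (intro power_mono le_imp_inverse_le) auto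
    also have "\<dots> = M powr (j / m) * (1 + \<epsilon>) powr (- real j)"
      using M \<epsilon> by (simp add: q_def power_inverse power_mult_distrib powr_realpow[symmetric] powr_powr powr_minus)
    finally have F: "F j \<le> M powr (j / m) * (1 + \<epsilon>) powr (- real j)" by (simp add: F_def)
    have main: "(real (k choose l))\<^sup>2 / real (n choose l) * F j
        \<le> (real (k choose l))\<^sup>2 * (M powr (j / m) / real (n choose l)) * (1 + \<epsilon>) powr (- real j)"
      using mult_left_mono[OF F, of "(real (k choose l))\<^sup>2 / real (n choose l)"] by (simp add: mult_ac)
    show ?thesis
    proof (cases "2 * (real l - 1) \<le> real k - 1")
      case True
      have "real (k choose l) \<le> real k ^ l"
        using binomial_le_pow[OF l] by (metis of_nat_le_iff of_nat_power)
      hence c: "(real (k choose l))\<^sup>2 \<le> (real k ^ 2) ^ l"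
        using power_mono[of "real (k choose l)" "real k ^ l" 2] by (simp add: power_mult[symmetric] mult.commute)
      define x where "x = (real l - 1) / (real k - 1)"
      have x: "1 / 2 \<le> 1 - x" using True k by (simp add: x_def field_simps)
      have "M powr (j / m) / real (n choose l) \<le> exp l * (real k / n) powr (l * (1 - x))"
        unfolding M_def j_def m_def x_def using l l2 k by (intro binomial_powr_ratio_le) auto
      also have "(real k / n) powr (l * (1 - x)) \<le> (real k / n) powr (l / 2)"
        using k mult_left_mono[OF x, of "real l"] by (intro powr_mono') auto
      also have "\<dots> \<le> (exp 1 * (1 + \<epsilon>) powr (- (real k - 1) / 2)) powr (l / 2)"
        using kn by (intro powr_mono2) auto
      also have "\<dots> = exp (l / 2) * (1 + \<epsilon>) powr (- (real k - 1) / 4 * l)"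
        by (simp add: powr_mult powr_powr exp_powr_real)
      also have "\<dots> \<le> exp l * (1 + \<epsilon>) powr (- (real k - 1) / 4 * l)"
        by (intro mult_right_mono) auto
      also have "exp (real l) * (exp l * (1 + \<epsilon>) powr (- (real k - 1) / 4 * l))
          = (exp 2 * (1 + \<epsilon>) powr (- (real k - 1) / 4)) ^ l"
        using \<epsilon> by (simp add: power_mult_distrib powr_realpow[symmetric] powr_powr exp_of_nat_mult[symmetric] exp_add[symmetric])
      finally have d: "M powr (j / m) / real (n choose l) \<le> (exp 2 * (1 + \<epsilon>) powr (- (real k - 1) / 4)) ^ l"
        by simp
      have "(real (k choose l))\<^sup>2 * (M powr (j / m) / real (n choose l)) * (1 + \<epsilon>) powr (- real j)
          \<le> (real (k choose l))\<^sup>2 * (M powr (j / m) / real (n choose l)) * 1"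
        using \<epsilon> by (intro mult_left_mono) (auto simp: powr_minus inverse_le_1_iff ge_one_powr_ge_zero)
      also have "\<dots> \<le> (real k ^ 2) ^ l * (exp 2 * (1 + \<epsilon>) powr (- (real k - 1) / 4)) ^ l * 1"
        using M by (intro mult_right_mono mult_mono c d) auto
      also have "\<dots> = a ^ l" by (simp add: a_def power_mult_distrib mult_ac)
      also have "\<dots> \<le> a ^ 1" using a0 a1 l2 by (intro power_decreasing) auto
      finally show ?thesis using main b0 by (simp add: j_def)
    next
      case False
      have "real (k choose l) \<le> 2 ^ k"
        using binomial_le_pow2[of k l] by (metis of_nat_le_iff of_nat_numeral of_nat_power)
      hence "(real (k choose l))\<^sup>2 \<le> (2 ^ k)\<^sup>2" by (intro power_mono) auto
      hence c: "(real (k choose l))\<^sup>2 \<le> 4 ^ k" by (simp add: power_mult[symmetric] power_mult_distrib[symmetric] power2_eq_square)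
      have "M powr (j / m) / real (n choose l) \<le> exp l"
        unfolding M_def j_def m_def by (rule binomial_powr_ratio_le_exp[OF l k])
      also have "\<dots> \<le> exp 1 ^ k" using l by (simp add: exp_of_nat_mult[symmetric])
      finally have d: "M powr (j / m) / real (n choose l) \<le> exp 1 ^ k" .
      have "((real k - 1) / 2)\<^sup>2 \<le> (real l - 1)\<^sup>2" using False k by (intro power_mono) auto
      also have "\<dots> \<le> real l * (real l - 1)" using l2 by (simp add: power2_eq_square mult_right_mono)
      finally have "(real k - 1)\<^sup>2 / 8 \<le> j" by (simp add: jreal power_divide)
      hence e: "(1 + \<epsilon>) powr (- real j) \<le> (1 + \<epsilon>) powr (- (real k - 1)\<^sup>2 / 8)"
        using \<epsilon> by (intro powr_mono) auto
      have "(real (k choose l))\<^sup>2 * (M powr (j / m) / real (n choose l)) * (1 + \<epsilon>) powr (- real j)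
          \<le> 4 ^ k * exp 1 ^ k * (1 + \<epsilon>) powr (- (real k - 1)\<^sup>2 / 8)"
        using M by (intro mult_mono c d e) auto
      also have "\<dots> = b" by (simp add: b_def power_mult_distrib)
      finally show ?thesis using main a0 by (simp add: j_def)
    qed
  qed
  have card: "card C = n choose k" "card (complete_edges k) = m"
    by (simp_all add: card_copies_complete card_complete_edges k m_def)
  have "(\<Sum>h\<in>C. \<Sum>h'\<in>{h'\<in>C. h \<inter> h' \<noteq> {}}. inverse p ^ card (h \<inter> h')) / (real (card C))\<^sup>2
      = (\<Sum>h\<in>C. \<Sum>h'\<in>C. F (card (h \<inter> h'))) / M\<^sup>2"
  proof -
    have "(\<Sum>h'\<in>{h'\<in>C. h \<inter> h' \<noteq> {}}. inverse p ^ card (h \<inter> h')) = (\<Sum>h'\<in>C. F (card (h \<inter> h')))"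
      if "h \<in> C" for h
      using finite_copies finite_copy[OF that] by (intro sum.mono_neutral_cong_left) (auto simp: F_def)
    thus ?thesis by (simp add: card M_def)
  qed
  also have "\<dots> \<le> (\<Sum>l\<le>k. (real (k choose l))\<^sup>2 / real (n choose l) * F (l choose 2))"
    unfolding M_def using p0 by (intro sum_clique_overlaps_le k) (auto simp: F_def)
  also have "\<dots> \<le> (\<Sum>l\<le>k. a + b)"
    by (intro sum_mono summand) auto
  also have "\<dots> = (real k + 1) * (a + b)" by simp
  finally have S: "(\<Sum>h\<in>C. \<Sum>h'\<in>{h'\<in>C. h \<inter> h' \<noteq> {}}. inverse p ^ card (h \<inter> h')) / (real (card C))\<^sup>2
      \<le> (real k + 1) * (a + b)" .
  have "m * (1 - 4 * ((real k + 1) * (a + b)))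
      \<le> m * (1 - 4 * ((\<Sum>h\<in>C. \<Sum>h'\<in>{h'\<in>C. h \<inter> h' \<noteq> {}}. inverse p ^ card (h \<inter> h')) / (real (card C))\<^sup>2))"
    by (intro mult_left_mono diff_left_mono S) auto
  also have "\<dots> \<le> MMSE n (complete_edges k) p"
    using MMSE_ge_second_moment[OF p0 p(2)] unfolding card .
  finally show ?thesis using m by (simp add: pos_le_divide_eq m_def mult.commute)
qed

section \<open>Absence of a transition for bounded graphs\<close>

text \<open>
  The densities \<open>q / 2\<close> and \<open>min 1 (3q / 2)\<close> lie on the two sides of \<open>q\<close> at bounded ratio, so thinning
  bounds the ambiguity at the first from below by a constant times the ambiguity at the second. The
  latter is of constant order: if \<open>3q / 2 \<le> 1\<close> because the error there is asymptotically full, and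
  otherwise because all copies are present at density 1.
\<close>

lemma not_AoN_at_bounded:
  assumes ev: "\<forall>\<^sub>F n in sequentially. planted_graph n (H n) \<and> card (H n) \<le> N \<and> 2 \<le> card (copies n (H n))"
  shows "\<not> AoN_at H q"
proof
  assume AoN: "AoN_at H q"
  hence q: "0 \<le> q n" "q n \<le> 1" for n by (auto simp: AoN_at_def)
  define p\<^sub>1 where "p\<^sub>1 n = q n / 2" for n
  define p\<^sub>2 where "p\<^sub>2 n = min 1 (3 / 2 * q n)" for n
  define f where "f p n = MMSE n (H n) (p n) / real (card (H n))" for p :: "nat \<Rightarrow> real" and n
  have p1: "0 \<le> p\<^sub>1 n" "p\<^sub>1 n \<le> 1" and p2: "0 \<le> p\<^sub>2 n" "p\<^sub>2 n \<le> 1" for n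
    using q[of n] by (auto simp: p\<^sub>1_def p\<^sub>2_def)
  have "(f p\<^sub>1 \<longlongrightarrow> 0) (inf sequentially (principal {n. p\<^sub>1 n \<le> (1 - 1 / 2) * q n}))"
    using AoN p1 unfolding AoN_at_def f_def by (auto elim!: allE[of _ "1 / 2"])
  hence lim0: "f p\<^sub>1 \<longlonglongrightarrow> 0"
    by (simp add: p\<^sub>1_def)
  have lim1: "(f p\<^sub>2 \<longlongrightarrow> 1) (inf sequentially (principal {n. (1 + 1 / 2) * q n \<le> p\<^sub>2 n}))"
    using AoN p2 unfolding AoN_at_def f_def by (auto elim!: allE[of _ "1 / 2"])
  define c :: real where "c = (1 / 3) ^ N / (4 * (real N + 1))"
  have "\<forall>\<^sub>F n in sequentially. f p\<^sub>1 n < c"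
    by (rule order_tendstoD(2)[OF lim0]) (simp add: c_def)
  moreover have "\<forall>\<^sub>F n in sequentially. (1 + 1 / 2) * q n \<le> p\<^sub>2 n \<longrightarrow> 1 / 2 < f p\<^sub>2 n"
    using order_tendstoD(1)[OF lim1, of "1 / 2"] by (simp add: eventually_inf_principal)
  ultimately have "\<forall>\<^sub>F n in sequentially. False"
    using ev
  proof eventually_elim
    case (elim n)
    then interpret planted_graph n "H n" by simp
    define m where "m = card (H n)"
    have mN: "m \<le> N" using elim by (simp add: m_def)
    \<comment> \<open>The maximum is the ratio of the two densities whether or not \<open>p\<^sub>2\<close> is capped at 1.\<close>
    define r where "r = max (q n / 2) (1 / 3)"
    have r: "1 / 3 \<le> r" "r \<le> 1" using q[of n] by (auto simp: r_def)
    have rp: "r * p\<^sub>2 n = p\<^sub>1 n"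
      using q[of n] by (auto simp: r_def p\<^sub>1_def p\<^sub>2_def min_def max_def)
    have amb2: "1 / 2 \<le> ambiguity (p\<^sub>2 n)"
    proof (cases "3 / 2 * q n \<le> 1")
      case True
      hence "1 / 2 < f p\<^sub>2 n" using elim by (auto simp: p\<^sub>2_def)
      moreover have "f p\<^sub>2 n \<le> ambiguity (p\<^sub>2 n)"
        using MMSE_le_ambiguity[OF p2] ambiguity_nonneg[OF p2, of n]
        by (cases "card (H n) = 0") (simp_all add: f_def pos_divide_le_eq mult.commute)
      ultimately show ?thesis by simp
    next
      case False
      hence "p\<^sub>2 n = 1" by (simp add: p\<^sub>2_def)
      thus ?thesis using ambiguity_1 elim by simp
    qed
    have "(1 / 3) ^ N * (1 / 2) \<le> r ^ m * ambiguity (p\<^sub>2 n)"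
    proof (rule mult_mono)
      have "(1 / 3) ^ N \<le> (1 / 3 :: real) ^ m" using mN by (intro power_decreasing) auto
      also have "\<dots> \<le> r ^ m" using r by (intro power_mono) auto
      finally show "(1 / 3) ^ N \<le> r ^ m" .
    qed (use r amb2 in auto)
    also have "\<dots> \<le> ambiguity (p\<^sub>1 n)"
      using ambiguity_thinning[OF p2, of r n] r unfolding rp m_def by simp
    also have "\<dots> \<le> 2 * MMSE n (H n) (p\<^sub>1 n)" by (rule ambiguity_le_MMSE[OF p1])
    finally have low: "(1 / 3) ^ N / 4 \<le> MMSE n (H n) (p\<^sub>1 n)" by simp
    hence "0 < MMSE n (H n) (p\<^sub>1 n)" by (rule less_le_trans[rotated]) simp
    hence m: "0 < m" using MMSE_le_card[OF p1, of n] by (simp add: m_def)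
    have "c \<le> (1 / 3) ^ N / 4 / m"
      unfolding c_def using m mN by (auto intro!: divide_left_mono)
    also have "\<dots> \<le> f p\<^sub>1 n" unfolding f_def m_def by (intro divide_right_mono low) auto
    finally show False using elim by simp
  qed
  thus False by simp
qed

section \<open>The transition for growing cliques\<close>

text \<open>
  The bounds on the error depend on \<open>n\<close> through \<open>k n\<close> alone, so their limits as \<open>k \<rightarrow> \<infinity>\<close> suffice.
\<close>

lemma AoN_at_p1M_clique:
  assumes lim: "filterlim k at_top sequentially" and k: "\<forall>\<^sub>F n in sequentially. 2 \<le> k n \<and> k n \<le> n"
  shows "AoN_at (\<lambda>n. complete_edges (k n)) (\<lambda>n. p1M n (complete_edges (k n)))"
  unfolding AoN_at_def
proof (intro conjI allI impI)
  fix n show "p1M n (complete_edges (k n)) \<in> {0..1}" by (rule p1M_bounds)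
next
  fix \<epsilon> :: real and p :: "nat \<Rightarrow> real"
  assume \<epsilon>: "0 < \<epsilon>" and p: "\<forall>n. p n \<in> {0..1}"
  let ?q = "\<lambda>n. p1M n (complete_edges (k n))"
  let ?f = "\<lambda>n. MMSE n (complete_edges (k n)) (p n) / real (card (complete_edges (k n)))"
  define a where "a k = real k ^ 2 * exp 2 * (1 + \<epsilon>) powr (- (real k - 1) / 4)" for k :: nat
  define b where "b k = (4 * exp 1) ^ k * (1 + \<epsilon>) powr (- (real k - 1)\<^sup>2 / 8)" for k :: nat
  let ?g = "\<lambda>k. 1 - 4 * ((real k + 1) * (a k + b k))"
  have a: "a \<longlonglongrightarrow> 0" unfolding a_def using \<epsilon> by real_asymp
  have g: "?g \<longlonglongrightarrow> 1" unfolding a_def b_def using \<epsilon> by real_asymp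
  have le1: "\<forall>\<^sub>F n in sequentially. ?f n \<le> 1"
    using k
  proof eventually_elim
    case (elim n)
    then interpret planted_graph n "complete_edges (k n)" by (intro planted_graph_complete) auto
    show ?case using MMSE_le_card[of "p n"] p by (auto simp: divide_le_eq_1)
  qed
  show "(?f \<longlongrightarrow> 1) (inf sequentially (principal {n. (1 + \<epsilon>) * ?q n \<le> p n}))"
  proof (rule tendsto_sandwich)
    have "\<forall>\<^sub>F n in sequentially. a (k n) < 1"
      using filterlim_compose[OF a lim] by (rule order_tendstoD) simp
    with k show "\<forall>\<^sub>F n in inf sequentially (principal {n. (1 + \<epsilon>) * ?q n \<le> p n}). ?g (k n) \<le> ?f n"
      unfolding eventually_inf_principal
    proof eventually_elim
      case (elim n)
      thus ?case
        using MMSE_clique_ge[of "k n" n \<epsilon> "p n"] \<epsilon> p by (auto simp: a_def b_def card_complete_edges)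
    qed
    show "((\<lambda>n. ?g (k n)) \<longlongrightarrow> 1) (inf sequentially (principal {n. (1 + \<epsilon>) * ?q n \<le> p n}))"
      by (rule tendsto_mono[OF inf_le1 filterlim_compose[OF g lim]])
    show "\<forall>\<^sub>F n in inf sequentially (principal {n. (1 + \<epsilon>) * ?q n \<le> p n}). ?f n \<le> 1"
      using le1 by (rule filter_leD[OF inf_le1])
  qed simp
  \<comment> \<open>The upper bound needs \<open>\<epsilon> < 1\<close>; for larger \<open>\<epsilon>\<close> the density is only smaller.\<close>
  define \<eta> where "\<eta> = min \<epsilon> (1 / 2)"
  have \<eta>: "0 < \<eta>" "\<eta> < 1" "\<eta> \<le> \<epsilon>" using \<epsilon> by (auto simp: \<eta>_def)
  show "(?f \<longlongrightarrow> 0) (inf sequentially (principal {n. p n \<le> (1 - \<epsilon>) * ?q n}))"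
  proof (rule tendstoI)
    fix e :: real assume e: "0 < e"
    define u where "u k = (real k + 1) * ((4 * exp 1) ^ k * (1 - \<eta>) powr (e / 2 * (real k * (real k - 1) / 2)))" for k :: nat
    have "u \<longlonglongrightarrow> 0"
    proof -
      define c where "c = - ln (1 - \<eta>) * e / 4"
      have c: "0 < c" using \<eta> e by (simp add: c_def mult_neg_pos)
      have exp_4: "(4 * exp 1) ^ k = exp ((1 + ln 4) * real k)" for k
        using exp_of_nat2_mult[of "1 + ln 4 :: real" k]
        by (simp only: exp_add exp_ln zero_less_numeral mult.commute)
      have "u k = (real k + 1) * exp ((1 + ln 4) * real k - c * (real k * (real k - 1)))" for k
        using \<eta> unfolding u_def c_def exp_4
        by (simp add: powr_def exp_add[symmetric] algebra_simps diff_divide_distrib)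
      moreover have "(\<lambda>k::nat. (real k + 1) * exp ((1 + ln 4) * real k - c * (real k * (real k - 1)))) \<longlonglongrightarrow> 0"
        using c by real_asymp
      ultimately show ?thesis by presburger
    qed
    hence "\<forall>\<^sub>F n in sequentially. u (k n) < e / 2"
      using order_tendstoD(2)[OF filterlim_compose[OF _ lim], of u 0 "e / 2"] e by simp
    with k show "\<forall>\<^sub>F n in inf sequentially (principal {n. p n \<le> (1 - \<epsilon>) * ?q n}). dist (?f n) 0 < e"
      unfolding eventually_inf_principal
    proof eventually_elim
      case (elim n)
      then interpret planted_graph n "complete_edges (k n)" by (intro planted_graph_complete) auto
      have "p n \<le> (1 - \<eta>) * ?q n" if "p n \<le> (1 - \<epsilon>) * ?q n"
      proof -
        have "(1 - \<epsilon>) * ?q n \<le> (1 - \<eta>) * ?q n"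
          using p1M_bounds[of n "complete_edges (k n)"] \<eta> by (intro mult_right_mono) auto
        thus ?thesis using that by simp
      qed
      hence "?f n \<le> e / 2 + u (k n)" if "p n \<le> (1 - \<epsilon>) * ?q n"
        using MMSE_clique_le[of "k n" n \<eta> "e / 2" "p n"] that elim \<eta> e p
        by (auto simp: u_def card_complete_edges choose_two_real)
      moreover have "0 \<le> ?f n" using MMSE_nonneg[of "p n"] p by simp
      ultimately show ?case using elim by auto
    qed
  qed
qed

theorem corollary3p5:
  fixes k :: "nat \<Rightarrow> nat"
  assumes "\<And>n. n \<ge> 2 \<Longrightarrow> 2 \<le> k n \<and> k n \<le> n"
  shows "(filterlim k at_top sequentially \<longrightarrow>
            AoN_at (\<lambda>n. complete_edges (k n)) (\<lambda>n. p1M n (complete_edges (k n))) \<and>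
            (\<forall>n\<ge>2. p1M n (complete_edges (k n))
               = real (n choose k n) powr (- 1 / real (k n choose 2))))
       \<and> ((\<lambda>n. real (k n)) \<in> O(\<lambda>_. 1) \<longrightarrow>
            \<not> (\<exists>q. AoN_at (\<lambda>n. complete_edges (k n)) q))"
proof (intro conjI impI)
  have k: "\<forall>\<^sub>F n in sequentially. 2 \<le> k n \<and> k n \<le> n"
    using eventually_ge_at_top[of 2] by eventually_elim (use assms in auto)
  show "AoN_at (\<lambda>n. complete_edges (k n)) (\<lambda>n. p1M n (complete_edges (k n)))"
    if "filterlim k at_top sequentially"
    using that k by (rule AoN_at_p1M_clique)
  show "\<forall>n\<ge>2. p1M n (complete_edges (k n)) = real (n choose k n) powr (- 1 / real (k n choose 2))"
    using assms p1M_complete by blast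
  assume "(\<lambda>n. real (k n)) \<in> O(\<lambda>_. 1)"
  then obtain c where "\<forall>\<^sub>F n in sequentially. norm (real (k n)) \<le> c * norm (1 :: real)"
    by (rule landau_o.bigE)
  hence B: "\<forall>\<^sub>F n in sequentially. k n \<le> nat \<lceil>c\<rceil>"
    by eventually_elim (simp add: le_nat_iff, linarith)
  have "\<forall>\<^sub>F n in sequentially. planted_graph n (complete_edges (k n)) \<and>
      card (complete_edges (k n)) \<le> nat \<lceil>c\<rceil> choose 2 \<and> 2 \<le> card (copies n (complete_edges (k n)))"
    using k B eventually_gt_at_top[of "nat \<lceil>c\<rceil>"]
  proof eventually_elim
    case (elim n)
    have "(k n choose 2) \<le> (nat \<lceil>c\<rceil> choose 2)" using elim by (intro binomial_right_mono) auto
    moreover have "1 < real (n choose k n)"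
    proof -
      have "1 < (real n / k n) ^ k n" using elim by (intro one_less_power) auto
      also have "\<dots> \<le> real (n choose k n)" using elim by (intro binomial_ge_n_over_k_pow_k) auto
      finally show ?thesis .
    qed
    ultimately show ?case
      using elim by (auto simp: planted_graph_complete card_complete_edges card_copies_complete)
  qed
  hence "\<not> AoN_at (\<lambda>n. complete_edges (k n)) q" for q by (rule not_AoN_at_bounded)
  thus "\<not> (\<exists>q. AoN_at (\<lambda>n. complete_edges (k n)) q)" by simp
qed

end
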